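(* Let $k=3$, let $m\ge 3$, let $(t_i)$ be a knot sequence as in the context, let $A=(\langle N_i,N_j\rangle)_{i,j=1}^m$ be the Gram matrix of the B-splines $N_1,\dots,N_m$ of order $3$ on this knot sequence, and let $1\le n\le m$. Let $A_n$ be the upper left $n\times n$ block of $A$ and $B_n=A_n^{-1}=(b^n_{i,j})_{i,j=1}^n$. Then \[ |b_{i,j}^n|\leq C_1\,\frac{q^{|i-j|}}{\eta_{ij}}\qquad\text{for all } 1\leq i,j\leq n, \] where $\eta_{ij}=t_{\max(i,j)+3}-t_{\min(i,j)}$, $q=(87/100)^{1/2}$, $C=12\,q^{-2}\left(\frac65\right)^2$ and $C_1=C\left(1+\frac{12}{75}\,\frac{C}{1-q^2}\right)$.
   Context: Knots: $t_1,\dots,t_{m+3}$ are real numbers with $0=t_1=t_2=t_3<t_4<\dots<t_m<t_{m+1}=t_{m+2}=t_{m+3}=1$ (for $m=3$: $t_1=t_2=t_3=0$, $t_4=t_5=t_6=1$). For $1\le i\le m$, $N_i=N_{i,3}$ is the ($L_\infty$-normalized, i.e. $\sum_i N_i\equiv 1$) quadratic B-spline of order $3$ with support $[t_i,t_{i+3}]$, given by $N_{i,1}=\mathbf 1_{[t_i,t_{i+1})}$ and $N_{i,l+1}(x)=\frac{x-t_i}{t_{i+l}-t_i}N_{i,l}(x)+\frac{t_{i+l+1}-x}{t_{i+l+1}-t_{i+1}}N_{i+1,l}(x)$ for $l=1,2$, where terms with zero denominator are taken to be $0$. The inner product is $\langle f,g\rangle=\int_0^1 f(x)g(x)\,dx$.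 For $1\le n\le m$, $A_n=(\langle N_i,N_j\rangle)_{i,j=1}^n$, which is invertible since the $N_i$ are linearly independent. *)

theory Defs
  imports "HOL-Analysis.Analysis" "Jordan_Normal_Form.Matrix"
begin

text \<open>
  Knot sequences are functions on \<^typ>\<open>nat\<close> of which only the values at \<open>1, \<dots>, m + 3\<close> are
  used; the first and the last knot have multiplicity three.  For \<open>m = 3\<close> the monotonicity
  condition just says \<open>t 3 < t 4\<close>.
\<close>

definition knot_sequence :: "nat \<Rightarrow> (nat \<Rightarrow> real) \<Rightarrow> bool" where
  "knot_sequence m t \<longleftrightarrow>
     t 1 = 0 \<and> t 2 = 0 \<and> t 3 = 0 \<and>
     (\<forall>i\<in>{3..m}. t i < t (i + 1)) \<and>
     t (m + 1) = 1 \<and> t (m + 2) = 1 \<and> t (m + 3) = 1"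

text \<open>
  \<open>bspline t l i\<close> is the B-spline \<open>N\<^sub>i\<^sub>,\<^sub>l\<close> of order \<open>l \<ge> 1\<close> (degree \<open>l - 1\<close>); the value at
  order \<open>0\<close> is a dummy.  Terms with zero denominator vanish because \<open>x / 0 = 0\<close>.
\<close>

fun bspline :: "(nat \<Rightarrow> real) \<Rightarrow> nat \<Rightarrow> nat \<Rightarrow> real \<Rightarrow> real" where
  "bspline t 0 i x = 0"
| "bspline t (Suc 0) i x = indicator {t i..<t (i + 1)} x"
| "bspline t (Suc (Suc k)) i x =
     (let l = Suc k in
        (x - t i) / (t (i + l) - t i) * bspline t l i x +
        (t (i + l + 1) - x) / (t (i + l + 1) - t (i + 1)) * bspline t l (i + 1) x)"

definition inner_L2 :: "(real \<Rightarrow> real) \<Rightarrow> (real \<Rightarrow> real) \<Rightarrow> real" where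
  "inner_L2 f g = integral {0..1} (\<lambda>x. f x * g x)"

text \<open>Matrices of \<^theory>\<open>Jordan_Normal_Form.Matrix\<close> are indexed from \<open>0\<close>, B-splines from \<open>1\<close>.\<close>

definition gram_matrix :: "(nat \<Rightarrow> real) \<Rightarrow> nat \<Rightarrow> real mat" where
  "gram_matrix t m =
     mat m m (\<lambda>(i, j). inner_L2 (bspline t 3 (i + 1)) (bspline t 3 (j + 1)))"

definition upper_left_block :: "nat \<Rightarrow> 'a mat \<Rightarrow> 'a mat" where
  "upper_left_block n A = mat n n (\<lambda>(i, j). A $$ (i, j))"

definition \<eta> :: "(nat \<Rightarrow> real) \<Rightarrow> nat \<Rightarrow> nat \<Rightarrow> real" where
  "\<eta> t i j = t (max i j + 3) - t (min i j)"

definition q_const :: real where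
  "q_const = sqrt (87 / 100)"

definition C_const :: real where
  "C_const = 12 * q_const powi (- 2) * (6 / 5)\<^sup>2"

definition C1_const :: real where
  "C1_const = C_const * (1 + 12 / 75 * (C_const / (1 - q_const\<^sup>2)))"

end

theory Submission
  imports Defs "Jordan_Normal_Form.Determinant"
begin

text \<open>
  On a knot interval a quadratic spline is described by its three Bernstein coefficients, so the Gram
  form is a sum of local forms.  Minimising the energy to the left of a knot with the last two
  coefficients prescribed gives a sequence of \<open>2 \<times> 2\<close> Schur complements, which obeys a recursion in
  the interval lengths and stays in an explicit polyhedral cone.  Let \<open>u\<^sub>l\<close> be the spline with
  coefficients \<open>1\<close> at \<open>l\<close> and \<open>0\<close> beyond \<open>l\<close> that is orthogonal to all earlier B-splines, and let
  \<open>E\<^sub>l\<close> be its energy.  Its coefficients alternate in sign, and multiplied by a potential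
  built from the Schur complement and the distance to the right end of the support they shrink by
  the factor \<open>93/100\<close> at every step to the left.  The inverse of the Gram block is the sum of
  the rank one matrices \<open>u\<^sub>l u\<^sub>l\<^sup>T / E\<^sub>l\<close>, which leads to a geometric series.
\<close>

subsection \<open>One step of the Schur complement recursion\<close>

text \<open>Ratios of neighbouring interval lengths are unrestricted, and for this reason the
  coefficients of a column need not shrink by a fixed factor. After the first interval, of length
  \<open>H\<close>, one has \<open>a = b = H / 12\<close>; if the second interval is much shorter,
  the ratio of the coefficients with indices \<open>1\<close> and \<open>2\<close> is close to
  \<open>b / a = 1\<close>. The two corrections in \<open>potential\<close> make up for this loss.
  In this example the next \<open>a\<close> is about \<open>H / 9\<close>, large compared with its
  own interval, and the potential rises from \<open>17/20 * s\<close> to about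
  \<open>(s - H) + 9 * (H / 9) = s\<close>. Alternating signs matter because the recursion for the
  coefficients has three terms: with known signs, one of the two terms on the right can simply be
  dropped from an upper bound. The factor \<open>93/100\<close> is a rational number slightly below
  \<open>q_const\<close>.\<close>

text \<open>
  \<open>H\<close> and \<open>h\<close> are the lengths of two consecutive knot intervals, and
  \<open>a p\<^sup>2 + 2 b p c + d c\<^sup>2\<close> is the minimal energy up to the knot between them, where \<open>p\<close> is the middle
  Bernstein coefficient on the left interval and \<open>c\<close> the value at the knot.  On the right
  interval the Bernstein coefficients are \<open>c = (h p + H y) / (H + h)\<close>, \<open>y\<close>, \<open>z\<close>.
  Minimality in \<open>p\<close> reads \<open>pivot * p + coef1 * y + coef2 * z = 0\<close>, after multiplication
  by \<open>(H + h)\<^sup>2\<close>; the entries of the next Schur complement are \<open>num_a\<close>, \<open>num_b\<close>, \<open>num_d\<close> over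
  \<open>pivot\<close>.
\<close>

definition pivot :: "real \<Rightarrow> real \<Rightarrow> real \<Rightarrow> real \<Rightarrow> real \<Rightarrow> real" where
  "pivot H h a b d = (H + h)\<^sup>2 * a + 2 * h * (H + h) * b + h\<^sup>2 * d + h ^ 3 / 5"

definition coef1 :: "real \<Rightarrow> real \<Rightarrow> real \<Rightarrow> real \<Rightarrow> real" where
  "coef1 H h b d = H * ((H + h) * b + h * (d + h / 5)) + h\<^sup>2 * (H + h) / 10"

definition coef2 :: "real \<Rightarrow> real \<Rightarrow> real" where
  "coef2 H h = h\<^sup>2 * (H + h) / 30"

definition num_a :: "real \<Rightarrow> real \<Rightarrow> real \<Rightarrow> real \<Rightarrow> real \<Rightarrow> real" where
  "num_a H h a b d = H\<^sup>2 * (a * d - b\<^sup>2) + h * H\<^sup>2 * a / 5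
     + 2 * h / 15 * ((H + h)\<^sup>2 * a + 2 * h * (H + h) * b + h\<^sup>2 * d)
     + h ^ 4 / 60 + h * H / 5 * ((H + h) * a + h * b)"

definition num_b :: "real \<Rightarrow> real \<Rightarrow> real \<Rightarrow> real \<Rightarrow> real \<Rightarrow> real" where
  "num_b H h a b d = h ^ 4 / 60
     + h / 10 * ((H + h)\<^sup>2 * a + 2 * h * (H + h) * b + h\<^sup>2 * d)
     + h * H / 30 * ((H + h) * a + h * b)"

definition num_d :: "real \<Rightarrow> real \<Rightarrow> real \<Rightarrow> real \<Rightarrow> real \<Rightarrow> real" where
  "num_d H h a b d = h / 5 * ((H + h)\<^sup>2 * a + 2 * h * (H + h) * b + h\<^sup>2 * d) + 7 * h ^ 4 / 180"

text \<open>
  The conditions are invariant under the recursion.  In \<open>18 * b \<le> 6 * a + H\<close> and in the last one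
  equality occurs when the preceding interval has length \<open>0\<close>.
\<close>

definition admissible :: "real \<Rightarrow> real \<Rightarrow> real \<Rightarrow> real \<Rightarrow> bool" where
  "admissible H a b d \<longleftrightarrow> 0 \<le> H \<and> H \<le> 12 * b \<and> 15 * b \<le> 2 * H \<and> 7 * H \<le> 36 * d \<and> 5 * d \<le> H \<and>
     18 * b \<le> 6 * a + H \<and> 72 * b \<le> 6 * a + 7 * H \<and> 16 * H + 72 * b \<le> 108 * d + 12 * a"

lemma nonneg_diffD: "0 < c \<Longrightarrow> 0 \<le> c * (y - x) \<Longrightarrow> x \<le> y" for c x y :: real
  by (simp add: zero_le_mult_iff)

text \<open>The origin \<open>u = v = z = 0\<close> is the Schur complement that results when the
  preceding data all vanish. The directions are chosen such that the facets through this point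
  become \<open>0 \<le> u\<close>, \<open>0 \<le> v\<close>, \<open>0 \<le> z\<close> and a
  homogeneous relation between the three.\<close>

lemma admissible_coords:
  assumes "admissible H a b d"
  obtains u v z where "a = H / 12 + 3 * v + u" "b = H / 12 + v" "d = 7 * H / 36 + z"
    "0 \<le> H" "0 \<le> u" "0 \<le> v" "0 \<le> z" "20 * v \<le> H" "180 * z \<le> H"
    "3 * v - u \<le> 9 * z" "36 * v \<le> 4 * u + H"
proof
  show "a = H / 12 + 3 * (b - H / 12) + (a + H / 6 - 3 * b)" "b = H / 12 + (b - H / 12)"
    "d = 7 * H / 36 + (d - 7 * H / 36)"
    by simp_all
qed (use assms in \<open>simp_all add: admissible_def field_simps\<close>)

lemma admissible_nonneg:
  assumes "admissible H a b d"
  shows "0 \<le> H" "H / 12 \<le> a" "0 \<le> a" "0 \<le> b" "0 \<le> d" "b \<le> 2 * H / 15" "d \<le> H / 5" "H / 12 \<le> b"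
    "7 * H / 36 \<le> d"
  using assms by (auto simp: admissible_def)

lemma admissible_det:
  assumes "admissible H a b d"
  shows "b\<^sup>2 \<le> a * d"
proof -
  from assms obtain u v z where *: "a = H / 12 + 3 * v + u" "b = H / 12 + v" "d = 7 * H / 36 + z"
    "0 \<le> H" "0 \<le> u" "0 \<le> v" "0 \<le> z" "20 * v \<le> H" by (rule admissible_coords)
  \<comment> \<open>The only negative monomial, the square of \<open>v\<close>, is absorbed by
    \<open>20 * v \<le> H\<close>.\<close>
  have "a * d - b\<^sup>2 = H\<^sup>2 / 108 + 22 * H * v / 60 + v * (H / 20 - v) + 7 * H * u / 36
      + (H / 12 + 3 * v + u) * z"
    unfolding * by (simp add: field_simps power2_eq_square)
  also have "\<dots> \<ge> 0" using *(4-8) by (intro add_nonneg_nonneg mult_nonneg_nonneg) auto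
  finally show ?thesis by simp
qed

lemma pivot_pos:
  assumes "admissible H a b d" "0 \<le> h" "0 < H + h"
  shows "0 < pivot H h a b d"
proof -
  note nn = admissible_nonneg[OF assms(1)]
  have "0 \<le> (H + h)\<^sup>2 * a" "0 \<le> 2 * h * (H + h) * b" "0 \<le> h\<^sup>2 * d" "0 \<le> h ^ 3"
    using assms nn by (auto intro!: mult_nonneg_nonneg)
  moreover have "0 < (H + h)\<^sup>2 * a \<or> 0 < h ^ 3"
  proof (cases "0 < h")
    case False
    then have "0 < H" using assms by auto
    then have "0 < a" using nn by auto
    then show ?thesis using assms by auto
  qed simp
  ultimately show ?thesis unfolding pivot_def by (elim disjE) linarith+
qed

lemma coef_nonneg:
  assumes "admissible H a b d" "0 \<le> h"
  shows "0 \<le> coef1 H h b d" "0 \<le> coef2 H h"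
  using assms admissible_nonneg[OF assms(1)]
  by (auto simp: coef1_def coef2_def intro!: add_nonneg_nonneg mult_nonneg_nonneg)

text \<open>Multiplied by the pivot, each condition on the new triple becomes a linear inequality in
  the nonnegative quantities \<open>P\<close>, \<open>K\<close>, \<open>M\<close>, \<open>X\<close>,
  \<open>S\<close>. Beyond their signs only \<open>M \<le> P\<close> and
  \<open>2 * M \<le> P + 2 * S\<close> enter, the latter for the facet
  \<open>72 * b \<le> 6 * a + 7 * H\<close>.\<close>

lemma admissible_step:
  assumes "admissible H a b d" "0 \<le> h" "0 < H + h"
  shows "admissible h (num_a H h a b d / pivot H h a b d) (num_b H h a b d / pivot H h a b d)
    (num_d H h a b d / pivot H h a b d)"
proof -
  note nn = admissible_nonneg[OF assms(1)]
  define P where "P = h * ((H + h)\<^sup>2 * a + 2 * h * (H + h) * b + h\<^sup>2 * d)"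
  define K where "K = h ^ 4"
  define M where "M = h * H * ((H + h) * a + h * b)"
  define X where "X = H\<^sup>2 * (a * d - b\<^sup>2)"
  define S where "S = h * H\<^sup>2 * a"
  define Q where "Q = pivot H h a b d"
  have Q: "0 < Q" unfolding Q_def by (rule pivot_pos[OF assms])
  have hQ: "h * Q = P + K / 5"
    by (simp add: Q_def pivot_def P_def K_def algebra_simps power_numeral_reduce)
  have na: "num_a H h a b d = X + S / 5 + 2 * P / 15 + K / 60 + M / 5"
    by (simp add: num_a_def X_def S_def P_def K_def M_def)
  have nb: "num_b H h a b d = K / 60 + P / 10 + M / 30"
    by (simp add: num_b_def P_def K_def M_def)
  have nd: "num_d H h a b d = P / 5 + 7 * K / 180"
    by (simp add: num_d_def P_def K_def)
  have pos: "0 \<le> P" "0 \<le> K" "0 \<le> M" "0 \<le> X" "0 \<le> S"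
    using nn assms(2) admissible_det[OF assms(1)]
    by (auto simp: P_def K_def M_def X_def S_def intro!: mult_nonneg_nonneg add_nonneg_nonneg)
  have "P - M = h * (h * (H + h) * a + h * (H + 2 * h) * b + h\<^sup>2 * d)"
    by (simp add: P_def M_def algebra_simps power2_eq_square)
  also have "\<dots> \<ge> 0" using nn assms(2) by (intro mult_nonneg_nonneg add_nonneg_nonneg) auto
  finally have MP: "M \<le> P" by simp
  have "P + 2 * S - 2 * M = h * ((H\<^sup>2 + h\<^sup>2) * a + 2 * h\<^sup>2 * b + h\<^sup>2 * d)"
    by (simp add: P_def M_def S_def algebra_simps power2_eq_square)
  also have "\<dots> \<ge> 0" using nn assms(2) by (intro mult_nonneg_nonneg add_nonneg_nonneg) auto
  finally have MPS: "2 * M \<le> P + 2 * S" by simp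
  define a' b' d' where "a' = num_a H h a b d / Q" and "b' = num_b H h a b d / Q"
    and "d' = num_d H h a b d / Q"
  have eqs: "Q * a' = X + S / 5 + 2 * P / 15 + K / 60 + M / 5" "Q * b' = K / 60 + P / 10 + M / 30"
    "Q * d' = P / 5 + 7 * K / 180" "Q * h = P + K / 5"
    using Q na nb nd hQ by (simp_all add: a'_def b'_def d'_def mult.commute)
  have comb: "0 \<le> w * a' + x * b' + y * d' + r * h"
    if "0 \<le> w * (Q * a') + x * (Q * b') + y * (Q * d') + r * (Q * h)" for w x y r
  proof -
    have "w * (Q * a') + x * (Q * b') + y * (Q * d') + r * (Q * h) = Q * (w * a' + x * b' + y * d' + r * h)"
      by (simp add: algebra_simps)
    with that Q show ?thesis by (simp add: zero_le_mult_iff)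
  qed
  have "h \<le> 12 * b'" using comb[of 0 12 0 "- 1"] pos MP unfolding eqs by simp
  moreover have "15 * b' \<le> 2 * h" using comb[of 0 "- 15" 0 2] pos MP unfolding eqs by simp
  moreover have "7 * h \<le> 36 * d'" using comb[of 0 0 36 "- 7"] pos unfolding eqs by simp
  moreover have "5 * d' \<le> h" using comb[of 0 0 "- 5" 1] pos unfolding eqs by simp
  moreover have "18 * b' \<le> 6 * a' + h" using comb[of 6 "- 18" 0 1] pos MP unfolding eqs by simp
  moreover have "72 * b' \<le> 6 * a' + 7 * h" using comb[of 6 "- 72" 0 7] pos MP MPS unfolding eqs by simp
  moreover have "16 * h + 72 * b' \<le> 108 * d' + 12 * a'"
    using comb[of 12 "- 72" 108 "- 16"] pos MP unfolding eqs by simp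
  ultimately show ?thesis
    using assms(2) by (simp add: admissible_def a'_def b'_def d'_def Q_def)
qed

text \<open>
  The coefficient of \<open>4 H\<^sup>3\<close> that survives at \<open>h = 0\<close> in the polynomial inequality \<open>step_poly_const\<close> below.
  It is the only part for which the last two conditions of \<open>admissible\<close> are needed.
\<close>

definition slack :: "real \<Rightarrow> real \<Rightarrow> real \<Rightarrow> real \<Rightarrow> real" where
  "slack H a b d = 837 / 100 * a * (a * d - b\<^sup>2) - b * (9 * a\<^sup>2 + H * a / 4 - H\<^sup>2 / 80)"

section \<open>Polynomial inequalities on the admissible cone\<close>

lemma scaled:
  fixes G k a b d :: real
  shows "pivot (180 * G) (180 * k) a b d = 32400 * (G + k)\<^sup>2 * a + 64800 * k * (G + k) * b + 32400 * k\<^sup>2 * d + 1166400 * k ^ 3"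
    "coef1 (180 * G) (180 * k) b d = 32400 * G * ((G + k) * b + k * (d + 36 * k)) + 583200 * k\<^sup>2 * (G + k)"
    "coef2 (180 * G) (180 * k) = 194400 * k\<^sup>2 * (G + k)"
    "num_a (180 * G) (180 * k) a b d = 32400 * G\<^sup>2 * (a * d - b\<^sup>2) + 1166400 * k * G\<^sup>2 * a
       + 777600 * k * ((G + k)\<^sup>2 * a + 2 * k * (G + k) * b + k\<^sup>2 * d)
       + 17496000 * k ^ 4 + 1166400 * k * G * ((G + k) * a + k * b)"
    "100 * slack (180 * G) a b d = 837 * a * (a * d - b\<^sup>2) - 100 * b * (9 * a\<^sup>2 + 45 * G * a - 405 * G\<^sup>2)"
  unfolding pivot_def coef1_def coef2_def num_a_def slack_def
  by (simp_all add: power_numeral_reduce field_simps)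

text \<open>
  The polynomial inequalities below are certified by writing the difference of both sides as a sum
  of monomials with nonnegative coefficients in quantities that are nonnegative on the admissible
  cone.  The scaling by \<open>180\<close> clears the denominators.
\<close>

lemma num_a_ge:
  assumes "admissible H a b d" "0 \<le> h"
  shows "(h / 12 + H / 9) * pivot H h a b d \<le> num_a H h a b d"
proof -
  from assms(1) obtain u v z where *: "a = H / 12 + 3 * v + u" "b = H / 12 + v" "d = 7 * H / 36 + z"
    and uvz: "0 \<le> H" "0 \<le> u" "0 \<le> v" "0 \<le> z" "20 * v \<le> H" "180 * z \<le> H" by (rule admissible_coords)
  define G k where "G = H / 180" and "k = h / 180"
  have nn: "0 \<le> G" "0 \<le> k" "0 \<le> u" "0 \<le> v" "0 \<le> z" "v \<le> 9 * G" "z \<le> G"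
    using uvz assms(2) by (simp_all add: G_def k_def)
  have Hh: "H = 180 * G" "h = 180 * k" by (simp_all add: G_def k_def)
  have abd: "a = 15 * G + 3 * v + u" "b = 15 * G + v" "d = 35 * G + z" using * by (simp_all add: Hh)
  have "1 * (num_a H h a b d - (1 / 12 * h + 1 / 9 * H) * pivot H h a b d) =
      num_a H h a b d - (15 * k + 20 * G) * pivot H h a b d"
    by (simp add: Hh field_simps)
  also have "\<dots> = 32400 * (9 * k ^ 3 * u + 45 * k ^ 3 * v + 9 * k ^ 3 * z + 34 * G * k ^ 2 * u +
      116 * G * k ^ 2 * v + 20 * G * k ^ 2 * (G - z) + 41 * G ^ 2 * k * u +
      83 * G ^ 2 * k * v + 15 * G ^ 3 * k + G ^ 2 * (9 * G - v) * v + G ^ 2 * u * z +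
      3 * G ^ 2 * v * z + 15 * G ^ 3 * u + 6 * G ^ 3 * v + 15 * G ^ 3 * z)"
    unfolding Hh scaled unfolding abd by Groebner_Basis.algebra
  also have "\<dots> \<ge> 0" using nn by (intro add_nonneg_nonneg mult_nonneg_nonneg zero_le_power) auto
  finally show ?thesis by simp
qed

text \<open>Both constants are limiting values on the cone as \<open>a\<close> grows: for
  \<open>h = 0\<close> the quotient is \<open>d - b^2 / a\<close> with \<open>5 * d \<le> H\<close>,
  and for \<open>H = 0\<close> it tends to \<open>2 * h / 15\<close>.\<close>

lemma num_a_le:
  assumes "admissible H a b d" "0 \<le> h"
  shows "num_a H h a b d \<le> (2 * h / 15 + H / 5) * pivot H h a b d"
proof -
  from assms(1) obtain u v z where *: "a = H / 12 + 3 * v + u" "b = H / 12 + v" "d = 7 * H / 36 + z"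
    and uvz: "0 \<le> H" "0 \<le> u" "0 \<le> v" "0 \<le> z" "20 * v \<le> H" "180 * z \<le> H" by (rule admissible_coords)
  define G k where "G = H / 180" and "k = h / 180"
  have nn: "0 \<le> G" "0 \<le> k" "0 \<le> u" "0 \<le> v" "0 \<le> z" "v \<le> 9 * G" "z \<le> G"
    using uvz assms(2) by (simp_all add: G_def k_def)
  have Hh: "H = 180 * G" "h = 180 * k" by (simp_all add: G_def k_def)
  have abd: "a = 15 * G + 3 * v + u" "b = 15 * G + v" "d = 35 * G + z" using * by (simp_all add: Hh)
  have "1 * ((2 / 15 * h + 1 / 5 * H) * pivot H h a b d - num_a H h a b d) =
      (24 * k + 36 * G) * pivot H h a b d - num_a H h a b d"
    by (simp add: Hh field_simps)
  also have "\<dots> = 32400 * (324 * k ^ 4 + 1296 * G * k ^ 3 + 36 * G * k ^ 2 * v + 36 * G * k ^ 2 * z +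
      1800 * G ^ 2 * k ^ 2 + 72 * G ^ 2 * k * v + 1080 * G ^ 3 * k + G ^ 2 * u * (G - z) +
      3 * G ^ 2 * v * (G - z) + G ^ 2 * v ^ 2 + 30 * G ^ 3 * v + 15 * G ^ 3 * (G - z) +
      225 * G ^ 4)"
    unfolding Hh scaled unfolding abd by Groebner_Basis.algebra
  also have "\<dots> \<ge> 0" using nn by (intro add_nonneg_nonneg mult_nonneg_nonneg zero_le_power) auto
  finally show ?thesis by simp
qed

lemma slack_mono: "d' \<le> d \<Longrightarrow> slack H a b d' \<le> slack H a b d"
proof -
  assume "d' \<le> d"
  moreover have "slack H a b d - slack H a b d' = 837 / 100 * a\<^sup>2 * (d - d')"
    by (simp add: slack_def field_simps power2_eq_square)
  moreover from \<open>d' \<le> d\<close> have "0 \<le> 837 / 100 * a\<^sup>2 * (d - d')" by simp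
  ultimately show ?thesis by linarith
qed

text \<open>
  As \<open>slack\<close> increases with \<open>d\<close>, it suffices to insert the lower bounds of \<open>d\<close>.  What remains is a cubic
  form on a three-dimensional cone, which has nonnegative coefficients in the coordinates \<open>p\<close>, \<open>q\<close>, \<open>r\<close>
  of each of four simplicial pieces.
\<close>

lemma slack_nonneg:
  assumes "admissible H a b d"
  shows "0 \<le> slack H a b d"
proof -
  from assms obtain u v z where *: "a = H / 12 + 3 * v + u" "b = H / 12 + v" "d = 7 * H / 36 + z"
    "0 \<le> H" "0 \<le> u" "0 \<le> v" "0 \<le> z" "20 * v \<le> H" "180 * z \<le> H"
    "3 * v - u \<le> 9 * z" "36 * v \<le> 4 * u + H" by (rule admissible_coords)
  show ?thesis
  proof (cases "3 * v \<le> u")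
    case True
    have "0 \<le> slack H a b (7 * H / 36)"
    proof (cases "24 * v \<le> H")
      case True
      define p q r where "p = H - 24 * v" and "q = v" and "r = u - 3 * v"
      have nn: "0 \<le> p" "0 \<le> q" "0 \<le> r" using * True \<open>3 * v \<le> u\<close> by (simp_all add: p_def q_def r_def)
      have eq: "H = p + 24 * q" "v = q" "u = r + 3 * q" by (simp_all add: p_def q_def r_def)
      have "14400 * (slack H a b (7 * H / 36)) = 152856 * p * q * r + 336708 * p * q ^ 2 + 12636 * p * r ^ 2 + 3696 * p ^ 2 * q +
      969 * p ^ 2 * r + 8 * p ^ 3 + 173664 * q * r ^ 2 + 1434672 * q ^ 2 * r + 673920 * q ^ 3"
        unfolding *(1,2) slack_def unfolding eq by (simp add: field_simps power_numeral_reduce)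
      also have "\<dots> \<ge> 0" using nn by (intro add_nonneg_nonneg mult_nonneg_nonneg zero_le_power) auto
      finally show ?thesis by simp
    next
      case False
      define p q r where "p = 6 * H - 120 * v" and "q = v - H / 24" and "r = u - 9 * v + H / 4"
      have nn: "0 \<le> p" "0 \<le> q" "0 \<le> r" using * False by (simp_all add: p_def q_def r_def)
      have eq: "H = p + 120 * q" "v = p / 24 + 6 * q" "u = r + p / 8 + 24 * q"
        by (simp_all add: p_def q_def r_def field_simps)
      have "19200 * (slack H a b (7 * H / 36)) = 868416 * p * q * r + 3637632 * p * q ^ 2 + 9648 * p * r ^ 2 + 29300 * p ^ 2 * q +
      3321 * p ^ 2 * r + 65 * p ^ 3 + 984960 * q * r ^ 2 + 52079616 * q ^ 2 * r +
      100104192 * q ^ 3"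
        unfolding *(1,2) slack_def unfolding eq by (simp add: field_simps power_numeral_reduce)
      also have "\<dots> \<ge> 0" using nn by (intro add_nonneg_nonneg mult_nonneg_nonneg zero_le_power) auto
      finally show ?thesis by simp
    qed
    also have "\<dots> \<le> slack H a b d" using * by (intro slack_mono) simp
    finally show ?thesis .
  next
    case False
    have "0 \<le> slack H a b (7 * H / 36 + (v / 3 - u / 9))"
    proof (cases "60 * v - 12 * u \<le> H")
      case True
      define p q r where "p = H - 60 * v + 12 * u" and "q = 60 * v - 20 * u" and "r = 8 * u"
      have nn: "0 \<le> p" "0 \<le> q" "0 \<le> r" using * True False by (simp_all add: p_def q_def r_def)
      have eq: "H = p + q + r" "v = q / 60 + r / 24" "u = r / 8" by (simp_all add: p_def q_def r_def field_simps)
      have "5760000 * (slack H a b (7 * H / 36 + (v / 3 - u / 9))) =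
          148480 * p * q * r + 14816 * p * q ^ 2 + 233825 * p * r ^ 2 + 12880 * p ^ 2 * q +
      61600 * p ^ 2 * r + 3200 * p ^ 3 + 143640 * q * r ^ 2 + 58536 * q ^ 2 * r +
      2976 * q ^ 3 + 19500 * r ^ 3"
        unfolding *(1,2) slack_def unfolding eq by (simp add: field_simps power_numeral_reduce)
      also have "\<dots> \<ge> 0" using nn by (intro add_nonneg_nonneg mult_nonneg_nonneg zero_le_power) auto
      finally show ?thesis by simp
    next
      case 2: False
      \<comment> \<open>Here \<open>0 \<le> p\<close> is the facet
        \<open>36 * v \<le> 4 * u + H\<close>, and \<open>0 \<le> r\<close> combines
        \<open>3 * v - u \<le> 9 * z\<close> with \<open>180 * z \<le> H\<close>.\<close>
      define p q r where "p = 10 * (u - 9 * v + H / 4)" and "q = 5 / 2 * (60 * v - 12 * u - H)"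
        and "r = 20 * (u - 3 * v + H / 20)"
      have nn: "0 \<le> p" "0 \<le> q" "0 \<le> r" using * 2 by (simp_all add: p_def q_def r_def)
      have eq: "H = p + q + r" "v = p / 60 + q / 30 + r / 24" "u = q / 20 + r / 8"
        by (simp_all add: p_def q_def r_def field_simps)
      have "14400000 * (slack H a b (7 * H / 36 + (v / 3 - u / 9))) =
          431480 * p * q * r + 112976 * p * q ^ 2 + 359100 * p * r ^ 2 + 66040 * p ^ 2 * q +
      146340 * p ^ 2 * r + 7440 * p ^ 3 + 183775 * q * r ^ 2 + 146120 * q ^ 2 * r +
      29428 * q ^ 3 + 48750 * r ^ 3"
        unfolding *(1,2) slack_def unfolding eq by (simp add: field_simps power_numeral_reduce)
      also have "\<dots> \<ge> 0" using nn by (intro add_nonneg_nonneg mult_nonneg_nonneg zero_le_power) auto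
      finally show ?thesis by simp
    qed
    also have "\<dots> \<le> slack H a b d" using * by (intro slack_mono) simp
    finally show ?thesis .
  qed
qed

text \<open>Both sides of \<open>potential_step\<close> are affine in \<open>s\<close>. This is the
  inequality at the smallest value \<open>s = H + h\<close>, multiplied by
  \<open>a * (3 * h + 4 * H)\<close>, with the new \<open>a\<close> in \<open>h / (80 * a)\<close>
  replaced by its lower bound from \<open>num_a_ge\<close>.\<close>

lemma step_poly_const:
  fixes H h u v z :: real
  assumes uvz: "0 \<le> H" "0 \<le> h" "0 \<le> u" "0 \<le> v" "0 \<le> z" "20 * v \<le> H" "180 * z \<le> H"
  defines "a \<equiv> H / 12 + 3 * v + u" and "b \<equiv> H / 12 + v" and "d \<equiv> 7 * H / 36 + z"
  shows "(coef1 H h b d + coef2 H h) * ((H + h) * (a - 1 / 80 * H) + 9 * a * (a - 1 / 12 * H)) * (3 * h + 4 * H)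
      + 4 * H ^ 3 * slack H a b d
    \<le> 93 / 100 * a * (h * (51 / 20 * h + 4 * H) * pivot H h a b d
      + 9 * (3 * h + 4 * H) * (num_a H h a b d - 1 / 12 * h * pivot H h a b d))" (is "?l \<le> ?r")
proof -
  define G k where "G = H / 180" and "k = h / 180"
  have nn: "0 \<le> G" "0 \<le> k" "0 \<le> u" "0 \<le> v" "0 \<le> z" "v \<le> 9 * G" "z \<le> G"
    using uvz by (simp_all add: G_def k_def)
  have Hh: "H = 180 * G" "h = 180 * k" by (simp_all add: G_def k_def)
  have abd: "a = 15 * G + 3 * v + u" "b = 15 * G + v" "d = 35 * G + z"
    by (simp_all add: a_def b_def d_def Hh)
  have "100 * (?r - ?l) =
      93 * a * (180 * k * (459 * k + 720 * G) * pivot H h a b d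
        + 9 * (540 * k + 720 * G) * (num_a H h a b d - 15 * k * pivot H h a b d))
      - 100 * ((coef1 H h b d + coef2 H h) * (45 * (G + k) * (4 * a - 9 * G) + 9 * a * (a - 15 * G)) * (540 * k + 720 * G))
        - 23328000 * G ^ 3 * (100 * slack H a b d)"
    by (simp add: Hh field_simps)
  also have "\<dots> = 52488000 * (725220 * G * k ^ 5 + 26748 * k ^ 5 * u + 80244 * k ^ 5 * v + 152970 * G * k ^ 4 * u +
      676530 * G * k ^ 4 * v + 108810 * G * k ^ 4 * z + 3848400 * G ^ 2 * k ^ 4 +
      14832 * k ^ 4 * u * v + 7254 * k ^ 4 * u * z + 54 * k ^ 4 * u ^ 2 +
      21762 * k ^ 4 * v * z + 44010 * k ^ 4 * v ^ 2 + 86568 * G * k ^ 3 * u * v +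
      4788 * G * k ^ 3 * u * z + 7740 * G * k ^ 3 * u ^ 2 + 14364 * G * k ^ 3 * v * z +
      190044 * G * k ^ 3 * v ^ 2 + 383700 * G ^ 2 * k ^ 3 * u + 1766520 * G ^ 2 * k ^ 3 * v +
      85320 * G ^ 2 * k ^ 3 * z + 7011000 * G ^ 3 * k ^ 3 +
      1800 * G * k ^ 2 * (9 * G - v) * u * v + 300 * G * k ^ 2 * (9 * G - v) * u ^ 2 +
      2700 * G * k ^ 2 * (9 * G - v) * v ^ 2 + 1800 * G * k ^ 2 * u * v * (G - z) +
      300 * G * k ^ 2 * u ^ 2 * (G - z) + 2700 * G * k ^ 2 * v ^ 2 * (G - z) +
      132328 * G ^ 2 * k ^ 2 * u * v + 18500 * G ^ 2 * k ^ 2 * u * (G - z) +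
      20310 * G ^ 2 * k ^ 2 * u ^ 2 + 55500 * G ^ 2 * k ^ 2 * v * (G - z) +
      214194 * G ^ 2 * k ^ 2 * v ^ 2 + 520320 * G ^ 3 * k ^ 2 * u +
      1830480 * G ^ 3 * k ^ 2 * v + 178500 * G ^ 3 * k ^ 2 * (G - z) +
      5516550 * G ^ 4 * k ^ 2 + 4479 * G ^ 2 * k * (9 * G - v) * u * v +
      700 * G ^ 2 * k * (9 * G - v) * u ^ 2 + 7137 * G ^ 2 * k * (9 * G - v) * v ^ 2 +
      726 * G ^ 2 * k * u * v * (G - z) + 121 * G ^ 2 * k * u ^ 2 * (G - z) +
      1089 * G ^ 2 * k * v ^ 2 * (G - z) + 55115 * G ^ 3 * k * u * v +
      5630 * G ^ 3 * k * u * (G - z) + 16416 * G ^ 3 * k * u ^ 2 +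
      16890 * G ^ 3 * k * v * (G - z) + 13416 * G ^ 3 * k * v ^ 2 + 374205 * G ^ 4 * k * u +
      716565 * G ^ 4 * k * v + 39225 * G ^ 4 * k * (G - z) + 1892475 * G ^ 5 * k)"
    unfolding Hh scaled unfolding abd by Groebner_Basis.algebra
  also have "\<dots> \<ge> 0" using nn by (intro add_nonneg_nonneg mult_nonneg_nonneg zero_le_power) auto
  finally show ?thesis by (rule nonneg_diffD[rotated]) simp
qed

text \<open>The corresponding inequality between the slopes in \<open>s\<close>.\<close>

lemma step_poly_linear:
  fixes H h u v z :: real
  assumes uvz: "0 \<le> H" "0 \<le> h" "0 \<le> u" "0 \<le> v" "0 \<le> z" "20 * v \<le> H" "180 * z \<le> H"
  defines "a \<equiv> H / 12 + 3 * v + u" and "b \<equiv> H / 12 + v" and "d \<equiv> 7 * H / 36 + z"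
  shows "(coef1 H h b d + coef2 H h) * (a - 1 / 80 * H) * (3 * h + 4 * H)
    \<le> 93 / 100 * a * (51 / 20 * h + 4 * H) * pivot H h a b d" (is "?l \<le> ?r")
proof -
  define G k where "G = H / 180" and "k = h / 180"
  have nn: "0 \<le> G" "0 \<le> k" "0 \<le> u" "0 \<le> v" "0 \<le> z" "v \<le> 9 * G" "z \<le> G"
    using uvz by (simp_all add: G_def k_def)
  have Hh: "H = 180 * G" "h = 180 * k" by (simp_all add: G_def k_def)
  have abd: "a = 15 * G + 3 * v + u" "b = 15 * G + v" "d = 35 * G + z"
    by (simp_all add: a_def b_def d_def Hh)
  have "100 * (?r - ?l) =
      93 * a * (459 * k + 720 * G) * pivot H h a b d - 25 * (coef1 H h b d + coef2 H h) * (4 * a - 9 * G) * (540 * k + 720 * G)"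
    by (simp add: Hh field_simps)
  also have "\<dots> = 291600 * (725220 * G * k ^ 4 + 26748 * k ^ 4 * u + 80244 * k ^ 4 * v + 166425 * G * k ^ 3 * u +
      641565 * G * k ^ 3 * v + 71145 * G * k ^ 3 * z + 2671200 * G ^ 2 * k ^ 3 +
      37944 * k ^ 3 * u * v + 4743 * k ^ 3 * u * z + 4743 * k ^ 3 * u ^ 2 +
      14229 * k ^ 3 * v * z + 71145 * k ^ 3 * v ^ 2 + 119922 * G * k ^ 2 * u * v +
      1440 * G * k ^ 2 * u * z + 16926 * G * k ^ 2 * u ^ 2 + 4320 * G * k ^ 2 * v * z +
      207432 * G * k ^ 2 * v ^ 2 + 353670 * G ^ 2 * k ^ 2 * u + 1350000 * G ^ 2 * k ^ 2 * v +
      35100 * G ^ 2 * k ^ 2 * z + 3251700 * G ^ 3 * k ^ 2 + 118618 * G ^ 2 * k * u * v +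
      8000 * G ^ 2 * k * u * (G - z) + 19623 * G ^ 2 * k * u ^ 2 +
      24000 * G ^ 2 * k * v * (G - z) + 179247 * G ^ 2 * k * v ^ 2 + 313890 * G ^ 3 * k * u +
      986370 * G ^ 3 * k * v + 102000 * G ^ 3 * k * (G - z) + 1413675 * G ^ 4 * k +
      36640 * G ^ 3 * u * v + 7440 * G ^ 3 * u ^ 2 + 42960 * G ^ 3 * v ^ 2 +
      103200 * G ^ 4 * u + 207600 * G ^ 4 * v + 144000 * G ^ 5)"
    unfolding Hh scaled unfolding abd by Groebner_Basis.algebra
  also have "\<dots> \<ge> 0" using nn by (intro add_nonneg_nonneg mult_nonneg_nonneg zero_le_power) auto
  finally show ?thesis by (rule nonneg_diffD[rotated]) simp
qed

text \<open>
  \<open>s\<close> stands for the distance from the left end of the interval of length \<open>H\<close> to the right end of the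
  spline.  For \<open>H = a = 0\<close> the quotient is \<open>0\<close>.
\<close>

definition potential :: "real \<Rightarrow> real \<Rightarrow> real \<Rightarrow> real" where
  "potential H a s = s * (1 - H / (80 * a)) + 9 * a - 3 * H / 4"

lemma potential_step:
  assumes adm: "admissible H a b d" and h: "0 \<le> h" and Hh: "0 < H + h" and s: "H + h \<le> s"
  shows "(coef1 H h b d + coef2 H h) * potential H a s
    \<le> 93 / 100 * pivot H h a b d * potential h (num_a H h a b d / pivot H h a b d) (s - H)"
proof (cases "a = 0")
  case True
  then have 0: "H = 0" "b = 0" "d = 0" "a = 0" using adm by (auto simp: admissible_def)
  with h Hh have "0 < h" by simp
  then have eq: "num_a H h a b d / pivot H h a b d = h / 12"
    by (simp add: 0 num_a_def pivot_def field_simps power_numeral_reduce)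
  have "potential h (num_a H h a b d / pivot H h a b d) (s - H) = 17 / 20 * s"
    unfolding eq using \<open>0 < h\<close> by (simp add: potential_def 0)
  then have "93 / 100 * pivot H h a b d * potential h (num_a H h a b d / pivot H h a b d) (s - H)
      = 1581 / 10000 * (h ^ 3 * s)"
    by (simp only:) (simp add: pivot_def 0)
  moreover have "(coef1 H h b d + coef2 H h) * potential H a s = 2 / 15 * (h ^ 3 * s)"
    by (simp add: potential_def coef1_def coef2_def 0 power_numeral_reduce)
  moreover have "0 \<le> h ^ 3 * s" using s h 0 by simp
  ultimately show ?thesis by linarith
next
  case False
  note nn = admissible_nonneg[OF adm]
  define N Q where "N = coef1 H h b d + coef2 H h" and "Q = pivot H h a b d"
  define a' where "a' = num_a H h a b d / Q"
  define m where "m = 3 * h + 4 * H"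
  define g where "g = s - H - h"
  have a: "0 < a" using False nn by simp
  have Q: "0 < Q" unfolding Q_def by (rule pivot_pos[OF adm h Hh])
  have N: "0 \<le> N" using coef_nonneg[OF adm h] by (simp add: N_def)
  have m: "0 < m" using h nn(1) Hh by (simp add: m_def)
  have na: "num_a H h a b d = Q * a'" using Q by (simp add: a'_def)
  have "(m / 36) * Q \<le> a' * Q"
    using num_a_ge[OF adm h] by (simp add: Q_def[symmetric] na m_def field_simps)
  then have a': "m / 36 \<le> a'" using Q by simp
  then have a'0: "0 < a'" using m by simp
  \<comment> \<open>Since \<open>36 / 80 = 9/20\<close>, the numerator becomes
    \<open>(3 - 9/20) * h + 4 * H\<close>, the origin of \<open>51/20\<close>.\<close>
  have "h / (80 * a') \<le> h / (80 * (m / 36))"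
    using a' m h by (intro divide_left_mono mult_left_mono mult_pos_pos) auto
  also have "\<dots> = 1 - (51 / 20 * h + 4 * H) / m" using m by (simp add: m_def field_simps)
  finally have *: "(51 / 20 * h + 4 * H) / m \<le> 1 - h / (80 * a')" by simp
  have "(h + g) * ((51 / 20 * h + 4 * H) / m) \<le> (h + g) * (1 - h / (80 * a'))"
    using * h s by (intro mult_left_mono) (auto simp: g_def)
  then have pot: "(h + g) * ((51 / 20 * h + 4 * H) / m) + 9 * a' - 3 * h / 4 \<le> potential h a' (s - H)"
    by (simp add: potential_def g_def)
  from adm obtain u v z where abd: "a = H / 12 + 3 * v + u" "b = H / 12 + v" "d = 7 * H / 36 + z"
    and uvz: "0 \<le> H" "0 \<le> u" "0 \<le> v" "0 \<le> z" "20 * v \<le> H" "180 * z \<le> H" by (rule admissible_coords)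
  have I: "N * (a - 1 / 80 * H) * m \<le> 93 / 100 * a * (51 / 20 * h + 4 * H) * Q"
    using step_poly_linear[OF uvz(1) h uvz(2-)] unfolding abd N_def Q_def m_def .
  have II: "N * ((H + h) * (a - 1 / 80 * H) + 9 * a * (a - 1 / 12 * H)) * m + 4 * H ^ 3 * slack H a b d
      \<le> 93 / 100 * a * (h * (51 / 20 * h + 4 * H) * Q + 9 * m * (Q * a' - 1 / 12 * h * Q))"
    using step_poly_const[OF uvz(1) h uvz(2-)] unfolding abd[symmetric] N_def[symmetric] Q_def[symmetric] m_def[symmetric] na .
  have "0 \<le> 4 * H ^ 3 * slack H a b d"
    using slack_nonneg[OF adm] nn(1) by simp
  with II have II': "N * ((H + h) * (a - 1 / 80 * H) + 9 * a * (a - 1 / 12 * H)) * m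
      \<le> 93 / 100 * a * (h * (51 / 20 * h + 4 * H) * Q + 9 * m * (Q * a' - 1 / 12 * h * Q))" by linarith
  have g: "0 \<le> g" using s by (simp add: g_def)
  have "(a * m) * (N * potential H a s)
      = N * ((H + h) * (a - 1 / 80 * H) + 9 * a * (a - 1 / 12 * H)) * m + g * (N * (a - 1 / 80 * H) * m)"
    using a by (simp add: potential_def g_def field_simps)
  also have "\<dots> \<le> 93 / 100 * a * (h * (51 / 20 * h + 4 * H) * Q + 9 * m * (Q * a' - 1 / 12 * h * Q))
      + g * (93 / 100 * a * (51 / 20 * h + 4 * H) * Q)"
    by (intro add_mono II' mult_left_mono I g)
  also have "\<dots> = (a * m) * (93 / 100 * Q * ((h + g) * ((51 / 20 * h + 4 * H) / m) + 9 * a' - 3 * h / 4))"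
    using m by (simp add: field_simps)
  also have "\<dots> \<le> (a * m) * (93 / 100 * Q * potential h a' (s - H))"
    using a m Q pot by (intro mult_left_mono) auto
  finally show ?thesis
    using a m by (simp add: N_def[symmetric] Q_def[symmetric] a'_def[symmetric])
qed

text \<open>From \<open>H \<le> 12 * a\<close> the factor of \<open>s\<close> is at least
  \<open>1 - 12/80 = 17/20\<close>, while \<open>9 * a - 3 * H / 4\<close> is at least
  \<open>r\<close>. The length \<open>r\<close> of the preceding interval extends \<open>s\<close>
  to the left end of the support of the B-spline.\<close>

lemma potential_ge:
  assumes "0 \<le> H" "0 \<le> r" "H / 12 + r / 9 \<le> a" "0 \<le> s"
  shows "17 / 20 * (s + r) \<le> potential H a s"
proof -
  have "H / (80 * a) \<le> 3 / 20"
  proof (cases "a = 0")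
    case False
    then have "0 < a" using assms by linarith
    then show ?thesis using assms by (simp add: field_simps)
  qed simp
  then have "s * (17 / 20) \<le> s * (1 - H / (80 * a))"
    using assms(4) by (intro mult_left_mono) auto
  then show ?thesis using assms by (simp add: potential_def)
qed

text \<open>
  The minimal energy when \<open>p = 1\<close> and \<open>y = z = 0\<close>, that is, the squared distance of a B-spline from the
  span of its predecessors.
\<close>

definition dist2 :: "real \<Rightarrow> real \<Rightarrow> real \<Rightarrow> real \<Rightarrow> real \<Rightarrow> real" where
  "dist2 H h a b d = a + 2 * (h / (H + h)) * b + (h / (H + h))\<^sup>2 * (d + h / 5)"

lemma potential_le_dist2:
  assumes adm: "admissible H a b d" and h: "0 \<le> h"
  shows "potential H a (H + h) \<le> 12 * dist2 H h a b d"
proof (cases "H + h = 0")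
  case True
  then have "H = 0" "h = 0" using h admissible_nonneg(1)[OF adm] by auto
  then show ?thesis using admissible_nonneg(3)[OF adm] by (simp add: potential_def dist2_def)
next
  case False
  note nn = admissible_nonneg[OF adm]
  define k where "k = h / (H + h)"
  have k: "0 \<le> k" "k * (H + h) = h" using False nn h by (auto simp: k_def)
  have "0 \<le> H / (80 * a)" using nn by simp
  then have "potential H a (H + h) \<le> (H + h) * 1 + 9 * a - 3 * H / 4"
    unfolding potential_def using nn h by (intro add_mono diff_mono mult_left_mono) auto
  \<comment> \<open>This is what remains after inserting the lower bounds of \<open>a\<close>,
    \<open>b\<close>, \<open>d\<close>; the square factor eliminates \<open>k\<close>.\<close>
  moreover have "0 \<le> (H + h)\<^sup>2 * (2 * k * H + k\<^sup>2 * (7 / 3 * H) + 12 / 5 * k\<^sup>2 * h - h)"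
  proof -
    have "(H + h)\<^sup>2 * (2 * k * H + k\<^sup>2 * (7 / 3 * H) + 12 / 5 * k\<^sup>2 * h - h)
        = 2 * (k * (H + h)) * (H + h) * H + (k * (H + h))\<^sup>2 * (7 / 3 * H) + 12 / 5 * (k * (H + h))\<^sup>2 * h
          - h * (H + h)\<^sup>2"
      by (simp add: power2_eq_square field_simps)
    also have "\<dots> = h * H\<^sup>2 + 7 / 3 * h\<^sup>2 * H + 7 / 5 * h ^ 3"
      unfolding k by (simp add: power_numeral_reduce field_simps)
    also have "\<dots> \<ge> 0" using nn h by simp
    finally show ?thesis .
  qed
  then have "0 \<le> 2 * k * H + k\<^sup>2 * (7 / 3 * H) + 12 / 5 * k\<^sup>2 * h - h"
    using False by (simp add: zero_le_mult_iff)
  moreover have "k * (H / 12) \<le> k * b" "k\<^sup>2 * (7 * H / 36) \<le> k\<^sup>2 * d"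
    using k by (intro mult_left_mono nn zero_le_power2; simp)+
  moreover have "H / 4 \<le> 3 * a" using nn by simp
  ultimately show ?thesis
    unfolding dist2_def k_def[symmetric] by (simp add: algebra_simps)
qed

text \<open>With this bound an energy in a denominator can be traded against the length of a
  support.\<close>

lemma dist2_le:
  assumes adm: "admissible H a b d" and h: "0 \<le> h" and a: "a \<le> 2 * H / 15 + r / 5" and r: "0 \<le> r"
  shows "dist2 H h a b d \<le> 4 / 15 * (r + H + h)"
proof (cases "H + h = 0")
  case True
  then have "H = 0" "h = 0" using h admissible_nonneg(1)[OF adm] by auto
  then show ?thesis using a r by (simp add: dist2_def)
next
  case False
  note nn = admissible_nonneg[OF adm]
  define k where "k = h / (H + h)"
  have k: "0 \<le> k" "k \<le> 1" "k * (H + h) = h" using False nn h by (auto simp: k_def)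
  then have kH: "k * H = h - k * h" by (simp add: algebra_simps)
  have "k * b \<le> k * (2 * H / 15)" "k\<^sup>2 * d \<le> k\<^sup>2 * (H / 5)"
    using k by (intro mult_left_mono nn zero_le_power2; simp)+
  then have "dist2 H h a b d \<le> a + 2 * (k * (2 * H / 15)) + k\<^sup>2 * (H / 5) + k\<^sup>2 * (h / 5)"
    unfolding dist2_def k_def[symmetric] by (simp add: algebra_simps)
  also have "\<dots> = a + 4 / 15 * (k * H) + k * (k * (H + h)) / 5"
    by (simp add: algebra_simps power2_eq_square)
  also have "\<dots> = a + 4 / 15 * h - k * h / 15" unfolding k(3) kH by (simp add: field_simps)
  also have "\<dots> \<le> 4 / 15 * (r + H + h)"
  proof -
    have "0 \<le> k * h" using k h by simp
    then show ?thesis using a r nn(1) by simp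
  qed
  finally show ?thesis .
qed

lemma dist2_pos:
  assumes "admissible H a b d" "0 \<le> h" "0 < a \<or> 0 < h"
  shows "0 < dist2 H h a b d"
proof -
  note nn = admissible_nonneg[OF assms(1)]
  have "0 \<le> 2 * (h / (H + h)) * b" "0 \<le> (h / (H + h))\<^sup>2 * (d + h / 5)" using nn assms(2) by simp_all
  moreover have "0 < (h / (H + h))\<^sup>2 * (d + h / 5)" if "0 < h" using that nn by simp
  ultimately show ?thesis using assms(3) nn(3) unfolding dist2_def by linarith
qed

text \<open>The extreme case of \<open>alternation_step\<close>: lower bounds of the Schur entries
  in the coefficients on the right, upper bounds in the pivot on the left.\<close>

lemma alternation_poly:
  fixes H h e :: real
  assumes "0 \<le> H" "0 \<le> h" "0 \<le> e"
  shows "25 * coef2 H h * (2 * h + H) * (2 * e + h) *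
      ((h + e)\<^sup>2 * (2 / 15 * h + 1 / 5 * H) + 4 / 15 * e * h * (h + e) + 1 / 5 * e\<^sup>2 * (h + e))
    \<le> 6 * (coef1 H h (1 / 12 * H) (7 / 36 * H) * (h + e) + coef2 H h * e) * (4 * e + 5 * h) *
       coef1 h e (1 / 12 * h) (7 / 36 * h)" (is "?l \<le> ?r")
proof -
  define G k j where "G = H / 180" and "k = h / 180" and "j = e / 180"
  have nn: "0 \<le> G" "0 \<le> k" "0 \<le> j" using assms by (simp_all add: G_def k_def j_def)
  have Hh: "H = 180 * G" "h = 180 * k" "e = 180 * j" by (simp_all add: G_def k_def j_def)
  have "1 * (?r - ?l) =
      6 * (coef1 H h (15 * G) (35 * G) * (180 * (k + j)) + coef2 H h * (180 * j)) * (720 * j + 900 * k) * coef1 h e (15 * k) (35 * k)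
      - 25 * coef2 H h * (360 * k + 180 * G) * (360 * j + 180 * k) * (32400 * (k + j)\<^sup>2 * (24 * k + 36 * G) + 1555200 * j * k * (k + j) + 1166400 * j\<^sup>2 * (k + j))"
    by (simp add: Hh field_simps power2_eq_square)
  also have "\<dots> = 204073344000000 * (150 * k ^ 8 + 450 * G * k ^ 7 + 180 * j * k ^ 7 + 3240 * G * j * k ^ 6 +
      450 * G ^ 2 * k ^ 6 + 900 * j ^ 2 * k ^ 6 + 12480 * G * j ^ 2 * k ^ 5 +
      4850 * G ^ 2 * j * k ^ 5 + 225 * G ^ 3 * k ^ 5 + 4188 * j ^ 3 * k ^ 5 +
      22224 * G * j ^ 3 * k ^ 4 + 18000 * G ^ 2 * j ^ 2 * k ^ 4 + 2175 * G ^ 3 * j * k ^ 4 +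
      5040 * j ^ 4 * k ^ 4 + 16848 * G * j ^ 4 * k ^ 3 + 27100 * G ^ 2 * j ^ 3 * k ^ 3 +
      7200 * G ^ 3 * j ^ 2 * k ^ 3 + 1728 * j ^ 5 * k ^ 3 + 4320 * G * j ^ 5 * k ^ 2 +
      17100 * G ^ 2 * j ^ 4 * k ^ 2 + 9840 * G ^ 3 * j ^ 3 * k ^ 2 + 3600 * G ^ 2 * j ^ 5 * k +
      5670 * G ^ 3 * j ^ 4 * k + 1080 * G ^ 3 * j ^ 5)"
    unfolding Hh scaled by Groebner_Basis.algebra
  also have "\<dots> \<ge> 0" using nn by (intro add_nonneg_nonneg mult_nonneg_nonneg zero_le_power) auto
  finally show ?thesis by (rule nonneg_diffD[rotated]) simp
qed

lemma alternation_step: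
  assumes adm: "admissible H a b d" "admissible h a' b' d'" and h: "0 < h" and e: "0 \<le> e"
    and a': "a' \<le> 2 * h / 15 + H / 5"
  shows "25 * coef2 H h * (2 * h + H) * (2 * e + h) * pivot h e a' b' d'
    \<le> 6 * (coef1 H h b d * (h + e) + coef2 H h * e) * (4 * e + 5 * h) * coef1 h e b' d'"
proof -
  note nn = admissible_nonneg[OF adm(1)] and nn' = admissible_nonneg[OF adm(2)]
  have "(h + e)\<^sup>2 * a' \<le> (h + e)\<^sup>2 * (2 * h / 15 + H / 5)"
    "2 * e * (h + e) * b' \<le> 2 * e * (h + e) * (2 * h / 15)" "e\<^sup>2 * d' \<le> e\<^sup>2 * (h / 5)"
    using h e a' nn' by (intro mult_left_mono; simp)+
  then have "pivot h e a' b' d' \<le> (h + e)\<^sup>2 * (2 * h / 15 + H / 5) + 2 * e * (h + e) * (2 * h / 15)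
      + e\<^sup>2 * (h / 5) + e ^ 3 / 5"
    unfolding pivot_def by linarith
  also have "\<dots> = (h + e)\<^sup>2 * (2 / 15 * h + 1 / 5 * H) + 4 / 15 * e * h * (h + e) + 1 / 5 * e\<^sup>2 * (h + e)"
    by (simp add: field_simps power_numeral_reduce)
  finally have p: "pivot h e a' b' d' \<le> \<dots>" .
  have c1: "coef1 H h (1 / 12 * H) (7 / 36 * H) \<le> coef1 H h b d"
    unfolding coef1_def using nn h by (intro add_mono mult_left_mono; simp)
  have c1': "coef1 h e (1 / 12 * h) (7 / 36 * h) \<le> coef1 h e b' d'"
    unfolding coef1_def using nn' h e by (intro add_mono mult_left_mono; simp)
  have c2: "0 \<le> coef2 H h" and c0: "0 \<le> coef1 H h b d"
    using coef_nonneg[OF adm(1)] h by auto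
  have c0': "0 \<le> coef1 h e (1 / 12 * h) (7 / 36 * h)"
    unfolding coef1_def using h e by simp
  have c00: "0 \<le> coef1 H h (1 / 12 * H) (7 / 36 * H)"
    unfolding coef1_def using h nn(1) by simp
  have "25 * coef2 H h * (2 * h + H) * (2 * e + h) * pivot h e a' b' d'
      \<le> 25 * coef2 H h * (2 * h + H) * (2 * e + h) *
      ((h + e)\<^sup>2 * (2 / 15 * h + 1 / 5 * H) + 4 / 15 * e * h * (h + e) + 1 / 5 * e\<^sup>2 * (h + e))"
    using p c2 h e nn by (intro mult_left_mono) auto
  also have "\<dots> \<le> 6 * (coef1 H h (1 / 12 * H) (7 / 36 * H) * (h + e) + coef2 H h * e) * (4 * e + 5 * h) *
       coef1 h e (1 / 12 * h) (7 / 36 * h)"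
    using nn h e by (intro alternation_poly) auto
  also have "\<dots> \<le> 6 * (coef1 H h b d * (h + e) + coef2 H h * e) * (4 * e + 5 * h) * coef1 h e b' d'"
    using c1 c1' c2 c0 c0' c00 h e by (intro mult_mono add_mono) auto
  finally show ?thesis .
qed

subsection \<open>Forms on a mesh\<close>

text \<open>The L2 inner product on the unit interval of two quadratic polynomials given by their
  Bernstein coefficients.\<close>

definition bern_form :: "real \<Rightarrow> real \<Rightarrow> real \<Rightarrow> real \<Rightarrow> real \<Rightarrow> real \<Rightarrow> real" where
  "bern_form x0 x1 x2 y0 y1 y2 =
     (6 * x0 * y0 + 3 * (x0 * y1 + x1 * y0) + (x0 * y2 + x2 * y0) + 4 * x1 * y1
      + 3 * (x1 * y2 + x2 * y1) + 6 * x2 * y2) / 30"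

text \<open>Stationarity is required of the first argument only: it makes the coefficient of
  \<open>p'\<close> vanish, so the bilinear form no longer depends on \<open>p'\<close>. Eliminating
  \<open>p\<close> then gives the Schur complement of the symmetric matrix with rows
  \<open>(Q, Y, Z)\<close>, \<open>(Y, Ryy, Ryz)\<close>, \<open>(Z, Ryz, Rzz)\<close>, in which the
  factor \<open>s^2\<close> cancels.\<close>

lemma schur_step:
  fixes H h a b d :: real
  defines "Q \<equiv> pivot H h a b d"
  assumes ne: "H + h \<noteq> 0" "Q \<noteq> 0"
    and rec: "Q * p + coef1 H h b d * y + coef2 H h * z = 0"
    and c: "c = (h * p + H * y) / (H + h)" and c': "c' = (h * p' + H * y') / (H + h)"
  shows "a * p * p' + b * (p * c' + c * p') + d * c * c' + h * bern_form c y z c' y' z' =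
    num_a H h a b d / Q * y * y' + num_b H h a b d / Q * (y * z' + z * y') + num_d H h a b d / Q * z * z'"
proof -
  define s where "s = H + h"
  define Y Z where "Y = coef1 H h b d" and "Z = coef2 H h"
  define Ryy Ryz Rzz where "Ryy = H\<^sup>2 * (d + h / 5) + H * s * h / 5 + 2 * h * s\<^sup>2 / 15"
    and "Ryz = s\<^sup>2 * h / 10 + H * s * h / 30" and "Rzz = s\<^sup>2 * h / 5"
  have s: "s \<noteq> 0" using ne by (simp add: s_def)
  have cs: "c * s = h * p + H * y" "c' * s = h * p' + H * y'" using c c' s by (simp_all add: s_def)
  have "s\<^sup>2 * (a * p * p' + b * (p * c' + c * p') + d * c * c' + h * bern_form c y z c' y' z')
      = a * s\<^sup>2 * p * p' + b * s * (p * (c' * s) + (c * s) * p') + d * (c * s) * (c' * s)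
      + h * (6 * (c * s) * (c' * s) + 3 * s * ((c * s) * y' + y * (c' * s)) + s * ((c * s) * z' + z * (c' * s))
        + s\<^sup>2 * (4 * y * y' + 3 * (y * z' + z * y') + 6 * z * z')) / 30"
    by (simp add: bern_form_def power2_eq_square field_simps)
  also have "\<dots> = p' * (Q * p + Y * y + Z * z) + y' * (Y * p + Ryy * y + Ryz * z)
      + z' * (Z * p + Ryz * y + Rzz * z)"
    unfolding cs unfolding Q_def pivot_def Y_def Z_def coef1_def coef2_def Ryy_def Ryz_def Rzz_def s_def
    by (simp add: power_numeral_reduce field_simps)
  also have "Q * p + Y * y + Z * z = 0" using rec by (simp add: Y_def Z_def)
  finally have 1: "s\<^sup>2 * (a * p * p' + b * (p * c' + c * p') + d * c * c' + h * bern_form c y z c' y' z')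
      = y' * (Y * p + Ryy * y + Ryz * z) + z' * (Z * p + Ryz * y + Rzz * z)" by simp
  have Qp: "Q * p = - (Y * y + Z * z)" using rec by (simp add: Y_def Z_def)
  have ids: "Q * Ryy - Y\<^sup>2 = s\<^sup>2 * num_a H h a b d" "Q * Ryz - Y * Z = s\<^sup>2 * num_b H h a b d"
    "Q * Rzz - Z\<^sup>2 = s\<^sup>2 * num_d H h a b d"
    unfolding Q_def pivot_def Y_def Z_def coef1_def coef2_def Ryy_def Ryz_def Rzz_def s_def
      num_a_def num_b_def num_d_def
    by (simp_all add: power_numeral_reduce field_simps)
  define L where "L = a * p * p' + b * (p * c' + c * p') + d * c * c' + h * bern_form c y z c' y' z'"
  define R where "R = num_a H h a b d * y * y' + num_b H h a b d * (y * z' + z * y') + num_d H h a b d * z * z'"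
  have "Q * (s\<^sup>2 * L)
      = y' * (Y * (Q * p) + Q * Ryy * y + Q * Ryz * z) + z' * (Z * (Q * p) + Q * Ryz * y + Q * Rzz * z)"
    unfolding 1[folded L_def] by (simp add: algebra_simps)
  also have "\<dots> = (Q * Ryy - Y\<^sup>2) * y * y' + (Q * Ryz - Y * Z) * (y * z' + z * y') + (Q * Rzz - Z\<^sup>2) * z * z'"
    unfolding Qp by (simp add: algebra_simps power2_eq_square)
  also have "\<dots> = s\<^sup>2 * R"
    unfolding ids by (simp add: R_def algebra_simps)
  finally have "Q * L = R" using s by (simp add: mult.left_commute)
  then have "L = R / Q" using ne(2) by (simp add: field_simps)
  then show ?thesis by (simp add: L_def R_def add_divide_distrib)
qed

text \<open>The \<open>k\<close>-th triple is the energy on the intervals \<open>1, ..., k\<close>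
  as a form in the coefficient \<open>k\<close> and the value at the right end of interval
  \<open>k\<close>; no interval contributes for \<open>k = 0\<close>.\<close>

primrec schur :: "(nat \<Rightarrow> real) \<Rightarrow> nat \<Rightarrow> real \<times> real \<times> real" where
  "schur g 0 = (0, 0, 0)"
| "schur g (Suc k) = (case schur g k of (a, b, d) \<Rightarrow>
     let H = g k; h = g (Suc k); Q = pivot H h a b d
     in (num_a H h a b d / Q, num_b H h a b d / Q, num_d H h a b d / Q))"

text \<open>
  If both intervals at a knot degenerate, the quotient is \<open>0\<close>; such a value occurs only with the
  factor \<open>0\<close>.
\<close>

definition knot_value :: "(nat \<Rightarrow> real) \<Rightarrow> nat \<Rightarrow> (nat \<Rightarrow> real) \<Rightarrow> real" where
  "knot_value g k x = (g (Suc k) * x k + g k * x (Suc k)) / (g k + g (Suc k))"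

definition local_form :: "(nat \<Rightarrow> real) \<Rightarrow> nat \<Rightarrow> (nat \<Rightarrow> real) \<Rightarrow> (nat \<Rightarrow> real) \<Rightarrow> real" where
  "local_form g k x y = g (Suc k) *
     bern_form (knot_value g k x) (x (Suc k)) (knot_value g (Suc k) x)
       (knot_value g k y) (y (Suc k)) (knot_value g (Suc k) y)"

text \<open>The stationarity equation of \<open>schur_step\<close>. Together with the equations for
  smaller indices it yields orthogonality to the B-spline with coefficient index
  \<open>k\<close>.\<close>

definition annihilates :: "(nat \<Rightarrow> real) \<Rightarrow> nat \<Rightarrow> (nat \<Rightarrow> real) \<Rightarrow> bool" where
  "annihilates g k x \<longleftrightarrow> (case schur g k of (a, b, d) \<Rightarrow>
     pivot (g k) (g (Suc k)) a b d * x k + coef1 (g k) (g (Suc k)) b d * x (Suc k)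
       + coef2 (g k) (g (Suc k)) * knot_value g (Suc k) x = 0)"

definition unit_fun :: "nat \<Rightarrow> nat \<Rightarrow> real" where
  "unit_fun i j = (if j = i then 1 else 0)"

definition knot_dist2 :: "(nat \<Rightarrow> real) \<Rightarrow> nat \<Rightarrow> real" where
  "knot_dist2 g k = (case schur g k of (a, b, d) \<Rightarrow> dist2 (g k) (g (Suc k)) a b d)"

text \<open>
  \<open>g k\<close> is the length of the interval from \<open>t\<^sub>k\<^sub>+\<^sub>2\<close> to \<open>t\<^sub>k\<^sub>+\<^sub>3\<close>, and the coefficient with index
  \<open>k\<close> belongs to \<open>N\<^sub>k\<^sub>+\<^sub>1\<close>.
\<close>

locale mesh =
  fixes g :: "nat \<Rightarrow> real" and M :: nat
  assumes g_0: "g 0 = 0" and g_pos: "1 \<le> k \<Longrightarrow> k \<le> M \<Longrightarrow> 0 < g k"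
    and g_end: "M < k \<Longrightarrow> g k = 0" and M: "1 \<le> M"
begin

lemma g_nonneg: "0 \<le> g k"
  using g_0 g_pos[of k] g_end[of k] by (cases "k = 0"; cases "k \<le> M") (auto intro: less_imp_le)

lemma g_sum_pos: "k \<le> M \<Longrightarrow> 0 < g k + g (Suc k)"
  using g_pos[of k] g_pos[of 1] M g_nonneg[of "Suc k"] g_0 by (cases "k = 0") auto

definition A where "A k = fst (schur g k)"
definition B where "B k = fst (snd (schur g k))"
definition D where "D k = snd (snd (schur g k))"

lemma schur_eq: "schur g k = (A k, B k, D k)"
  by (simp add: A_def B_def D_def)

abbreviation "piv k \<equiv> pivot (g k) (g (Suc k)) (A k) (B k) (D k)"
abbreviation "cf1 k \<equiv> coef1 (g k) (g (Suc k)) (B k) (D k)"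
abbreviation "cf2 k \<equiv> coef2 (g k) (g (Suc k))"

lemma schur_0: "A 0 = 0" "B 0 = 0" "D 0 = 0"
  by (simp_all add: A_def B_def D_def)

lemma schur_Suc:
  "A (Suc k) = num_a (g k) (g (Suc k)) (A k) (B k) (D k) / piv k"
  "B (Suc k) = num_b (g k) (g (Suc k)) (A k) (B k) (D k) / piv k"
  "D (Suc k) = num_d (g k) (g (Suc k)) (A k) (B k) (D k) / piv k"
  unfolding A_def[of "Suc k"] B_def[of "Suc k"] D_def[of "Suc k"] unfolding schur.simps(2)
  unfolding schur_eq by (simp_all add: Let_def)

lemma adm: "k \<le> Suc M \<Longrightarrow> admissible (g k) (A k) (B k) (D k)"
proof (induction k)
  case 0
  then show ?case by (simp add: schur_0 g_0 admissible_def)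
next
  case (Suc k)
  then show ?case
    unfolding schur_Suc by (intro admissible_step g_sum_pos g_nonneg) auto
qed

lemma piv_pos: "k \<le> M \<Longrightarrow> 0 < piv k"
  by (intro pivot_pos adm g_sum_pos g_nonneg) auto

lemma annihilates_iff:
  "annihilates g k x \<longleftrightarrow> piv k * x k + cf1 k * x (Suc k) + cf2 k * knot_value g (Suc k) x = 0"
  by (simp add: annihilates_def schur_eq)

lemma A_ge: "k \<le> Suc M \<Longrightarrow> g k / 12 + g (k - 1) / 9 \<le> A k"
proof (cases k)
  case (Suc l)
  assume "k \<le> Suc M"
  then show ?thesis
    using num_a_ge[OF adm[of l] g_nonneg, of "Suc l"] piv_pos[of l]
    by (simp add: Suc schur_Suc pos_le_divide_eq)
qed (simp add: g_0 schur_0)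

lemma A_le: "k \<le> Suc M \<Longrightarrow> A k \<le> 2 * g k / 15 + g (k - 1) / 5"
proof (cases k)
  case (Suc l)
  assume "k \<le> Suc M"
  then show ?thesis
    using num_a_le[OF adm[of l] g_nonneg, of "Suc l"] piv_pos[of l]
    by (simp add: Suc schur_Suc pos_divide_le_eq)
qed (simp add: g_0 schur_0)

lemma form_schur:
  assumes "k \<le> Suc M" "\<And>l. l < k \<Longrightarrow> annihilates g l x"
  shows "(\<Sum>l<k. local_form g l x y) = A k * x k * y k
    + B k * (x k * knot_value g k y + knot_value g k x * y k) + D k * knot_value g k x * knot_value g k y"
  using assms
proof (induction k)
  case 0
  then show ?case by (simp add: schur_0)
next
  case (Suc k)
  then have IH: "(\<Sum>l<k. local_form g l x y) = A k * x k * y k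
    + B k * (x k * knot_value g k y + knot_value g k x * y k) + D k * knot_value g k x * knot_value g k y"
    by simp
  have "(\<Sum>l<Suc k. local_form g l x y) = A k * x k * y k
    + B k * (x k * knot_value g k y + knot_value g k x * y k) + D k * knot_value g k x * knot_value g k y
    + g (Suc k) * bern_form (knot_value g k x) (x (Suc k)) (knot_value g (Suc k) x)
       (knot_value g k y) (y (Suc k)) (knot_value g (Suc k) y)"
    unfolding sum.lessThan_Suc IH by (simp add: local_form_def)
  also have "\<dots> = A (Suc k) * x (Suc k) * y (Suc k)
      + B (Suc k) * (x (Suc k) * knot_value g (Suc k) y + knot_value g (Suc k) x * y (Suc k))
      + D (Suc k) * knot_value g (Suc k) x * knot_value g (Suc k) y"
    unfolding schur_Suc
  proof (rule schur_step)
    show "g k + g (Suc k) \<noteq> 0" using g_sum_pos[of k] Suc.prems by simp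
    show "piv k \<noteq> 0" using piv_pos[of k] Suc.prems by simp
    show "piv k * x k + cf1 k * x (Suc k) + cf2 k * knot_value g (Suc k) x = 0"
      using Suc.prems(2)[of k] by (simp add: annihilates_iff)
  qed (simp_all add: knot_value_def)
  finally show ?case .
qed

section \<open>The Gram form and orthogonality to preceding B-splines\<close>

definition form :: "(nat \<Rightarrow> real) \<Rightarrow> (nat \<Rightarrow> real) \<Rightarrow> real" where
  "form x y = (\<Sum>l<M. local_form g l x y)"

lemma form_commute: "form x y = form y x"
  by (auto simp: form_def local_form_def bern_form_def algebra_simps intro!: sum.cong)

lemma form_unit:
  assumes "k \<le> Suc M"
  shows "form x (unit_fun k) = (\<Sum>l<Suc k. local_form g l x (unit_fun k))"
proof -
  have 1: "local_form g l x (unit_fun k) = 0" if "k < l" for l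
    using that by (simp add: local_form_def knot_value_def unit_fun_def bern_form_def)
  \<comment> \<open>For \<open>k \<ge> M\<close> the sum up to \<open>Suc k\<close> runs past the
    last interval; the extra summands have length \<open>0\<close>.\<close>
  have 2: "local_form g l x (unit_fun k) = 0" if "M \<le> l" for l
    using that by (simp add: local_form_def g_end)
  have "(\<Sum>l<M. local_form g l x (unit_fun k)) = (\<Sum>l<max M (Suc k). local_form g l x (unit_fun k))"
    by (intro sum.mono_neutral_left) (auto intro!: 2)
  also have "\<dots> = (\<Sum>l<Suc k. local_form g l x (unit_fun k))"
    by (intro sum.mono_neutral_right) (auto intro!: 1)
  finally show ?thesis by (simp add: form_def)
qed

lemma form_unit_schur:
  assumes "k \<le> Suc M" "\<And>l. l < k \<Longrightarrow> annihilates g l x"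
  defines "\<kappa> \<equiv> g (Suc k) / (g k + g (Suc k))"
  shows "form x (unit_fun k) = A k * x k + B k * (x k * \<kappa> + knot_value g k x) + D k * knot_value g k x * \<kappa>
    + g (Suc k) * \<kappa> * (6 * knot_value g k x + 3 * x (Suc k) + knot_value g (Suc k) x) / 30"
proof -
  have "knot_value g k (unit_fun k) = \<kappa>" "unit_fun k k = 1" "unit_fun k (Suc k) = 0"
    "knot_value g (Suc k) (unit_fun k) = 0"
    by (simp_all add: knot_value_def unit_fun_def \<kappa>_def)
  then show ?thesis
    using form_schur[OF assms(1,2), of "unit_fun k"]
    by (simp add: form_unit[OF assms(1)] local_form_def bern_form_def algebra_simps)
qed

text \<open>Multiplied by \<open>s^2\<close>, the inner product is exactly the left side of the
  equation \<open>annihilates g k x\<close>.\<close>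

lemma form_annihilated:
  assumes "k \<le> M" "\<And>l. l \<le> k \<Longrightarrow> annihilates g l x"
  shows "form x (unit_fun k) = 0"
proof -
  define s where "s = g k + g (Suc k)"
  have s: "0 < s" using g_sum_pos[OF assms(1)] by (simp add: s_def)
  have kv: "knot_value g k x * s = g (Suc k) * x k + g k * x (Suc k)"
    using s by (simp add: knot_value_def s_def)
  define c where "c = knot_value g k x"
  define k' where "k' = g (Suc k) / s"
  have k': "k' * s = g (Suc k)" using s by (simp add: k'_def)
  have "form x (unit_fun k) = A k * x k + B k * (x k * k' + c) + D k * c * k'
    + g (Suc k) * k' * (6 * c + 3 * x (Suc k) + knot_value g (Suc k) x) / 30"
    using form_unit_schur[of k x] assms by (simp add: c_def k'_def s_def)
  then have "s\<^sup>2 * form x (unit_fun k) = A k * x k * s\<^sup>2 + B k * s * (x k * (k' * s) + (c * s)) + D k * (c * s) * (k' * s)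
    + g (Suc k) * (k' * s) * (6 * (c * s) + 3 * s * x (Suc k) + s * knot_value g (Suc k) x) / 30"
    by (simp add: power2_eq_square field_simps)
  also have "\<dots> = piv k * x k + cf1 k * x (Suc k) + cf2 k * knot_value g (Suc k) x"
    unfolding c_def kv k' unfolding s_def pivot_def coef1_def coef2_def
    by (simp add: power_numeral_reduce field_simps)
  also have "\<dots> = 0" using assms(2)[of k] by (simp add: annihilates_iff)
  finally show ?thesis using s by simp
qed

lemma form_last:
  assumes "n \<le> Suc M" "\<And>l. l < n \<Longrightarrow> annihilates g l x" "x n = 1" "\<And>l. n < l \<Longrightarrow> x l = 0"
  shows "form x (unit_fun n) = knot_dist2 g n"
proof -
  define \<kappa> where "\<kappa> = g (Suc n) / (g n + g (Suc n))"
  have kv: "knot_value g n x = \<kappa>" "knot_value g (Suc n) x = 0" "x (Suc n) = 0"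
    using assms(3,4) by (simp_all add: knot_value_def \<kappa>_def)
  show ?thesis
    using form_unit_schur[OF assms(1,2)]
    unfolding knot_dist2_def schur_eq prod.case dist2_def \<kappa>_def[symmetric] kv assms(3)
    by (simp add: field_simps power2_eq_square)
qed

text \<open>Back substitution: equation \<open>l\<close> involves only the coefficients
  \<open>l\<close>, \<open>l + 1\<close>, \<open>l + 2\<close> and has a positive pivot, so fixing
  coefficient \<open>k\<close> leaves the equations above \<open>k\<close> intact.\<close>

lemma column_exists:
  assumes "n \<le> Suc M"
  shows "\<exists>x. x n = 1 \<and> (\<forall>l>n. x l = 0) \<and> (\<forall>l<n. annihilates g l x)"
proof -
  have "\<exists>x. x n = 1 \<and> (\<forall>l>n. x l = 0) \<and> (\<forall>l<n. n - j \<le> l \<longrightarrow> annihilates g l x)" if "j \<le> n" for j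
    using that
  proof (induction j)
    case 0
    then show ?case by (intro exI[of _ "unit_fun n"]) (auto simp: unit_fun_def)
  next
    case (Suc j)
    then obtain x where x: "x n = 1" "\<forall>l>n. x l = 0" "\<forall>l<n. n - j \<le> l \<longrightarrow> annihilates g l x" by auto
    define k where "k = n - Suc j"
    have k: "k < n" "n - j = Suc k" using Suc.prems by (auto simp: k_def)
    define y where "y = x(k := - (cf1 k * x (Suc k) + cf2 k * knot_value g (Suc k) x) / piv k)"
    have yx: "y l = x l" if "l \<noteq> k" for l using that by (simp add: y_def)
    have kv: "knot_value g (Suc l) y = knot_value g (Suc l) x" if "k \<le> l" for l
      using that by (simp add: knot_value_def yx)
    have "annihilates g l y" if "l < n" "k \<le> l" for l
    proof (cases "l = k")
      case True
      have "piv k \<noteq> 0" using piv_pos[of k] k assms by simp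
      then show ?thesis using True by (simp add: annihilates_iff kv yx) (simp add: y_def)
    next
      case False
      then have "annihilates g l x" using that x(3) k by auto
      then show ?thesis using False that by (simp add: annihilates_iff kv yx)
    qed
    then show ?case using x(1,2) k by (intro exI[of _ y]) (auto simp: yx k_def)
  qed
  from this[of n] show ?thesis by auto
qed

definition pos :: "nat \<Rightarrow> real" where "pos k = (\<Sum>l<k. g l)"

lemma pos_Suc: "pos (Suc k) = pos k + g k"
  by (simp add: pos_def)

lemma pos_mono: "k \<le> l \<Longrightarrow> pos k \<le> pos l"
  unfolding pos_def by (intro sum_mono2) (auto intro: g_nonneg)

end

subsection \<open>Decay of the columns\<close>

locale mesh_column = mesh +
  fixes n :: nat and x :: "nat \<Rightarrow> real"
  assumes n: "n \<le> Suc M" and x_n: "x n = 1" and x_gt: "n < l \<Longrightarrow> x l = 0"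
    and x_ann: "l < n \<Longrightarrow> annihilates g l x"
begin

definition X :: "nat \<Rightarrow> real" where "X k = (- 1) ^ (n + k) * x k"

lemma X_abs: "\<bar>X k\<bar> = \<bar>x k\<bar>"
  by (simp add: X_def abs_mult)

lemma X_rec:
  assumes "k < n"
  defines "s \<equiv> g (Suc k) + g (Suc (Suc k))"
  shows "piv k * X k = (cf1 k + cf2 k * (g (Suc (Suc k)) / s)) * X (Suc k)
    - cf2 k * (g (Suc k) / s) * X (Suc (Suc k))"
proof -
  have "(- 1) ^ (n + k) * (piv k * x k + cf1 k * x (Suc k) + cf2 k * knot_value g (Suc k) x) = 0"
    using x_ann[OF assms(1)] by (simp add: annihilates_iff)
  then show ?thesis
    unfolding X_def knot_value_def s_def by (simp add: algebra_simps add_divide_distrib)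
qed

text \<open>
  The hypothesis \<open>alt\<close> keeps the second term of \<open>X_rec\<close> below the fraction \<open>6h / (5(2h + H))\<close> of the
  first one, where \<open>H\<close> and \<open>h\<close> are the lengths with index \<open>k\<close> and \<open>k + 1\<close>.
\<close>

lemma X_bounds_of:
  assumes k: "k < n" and nn: "0 \<le> X (Suc k)" "0 \<le> X (Suc (Suc k))"
    and alt: "5 * (2 * g (Suc k) + g k) * cf2 k * g (Suc k) * X (Suc (Suc k))
      \<le> 6 * g (Suc k) * (cf1 k * (g (Suc k) + g (Suc (Suc k))) + cf2 k * g (Suc (Suc k))) * X (Suc k)"
  shows "piv k * X k \<le> (cf1 k + cf2 k) * X (Suc k)" (is ?thesis1)
    and "(4 * g (Suc k) + 5 * g k) * cf1 k * X (Suc k) \<le> 5 * (2 * g (Suc k) + g k) * (piv k * X k)" (is ?thesis2)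
proof -
  define H h e where "H = g k" and "h = g (Suc k)" and "e = g (Suc (Suc k))"
  define Y Z Q where "Y = cf1 k" and "Z = cf2 k" and "Q = piv k"
  have ge: "0 \<le> H" "0 \<le> h" "0 \<le> e" by (simp_all add: H_def h_def e_def g_nonneg)
  have YZ: "0 \<le> Y" "0 \<le> Z"
    using coef_nonneg[OF adm g_nonneg, of k "Suc k"] k n by (simp_all add: Y_def Z_def)
  have rec: "Q * X k = (Y + Z * (e / (h + e))) * X (Suc k) - Z * (h / (h + e)) * X (Suc (Suc k))"
    using X_rec[OF k] by (simp add: Y_def Z_def Q_def h_def e_def)
  have alt': "5 * (2 * h + H) * Z * h * X (Suc (Suc k)) \<le> 6 * h * (Y * (h + e) + Z * e) * X (Suc k)"
    using alt by (simp add: Y_def Z_def h_def e_def H_def)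
  have "e / (h + e) \<le> 1" using ge by (cases "h + e = 0") auto
  then have "Z * (e / (h + e)) * X (Suc k) \<le> Z * 1 * X (Suc k)"
    using YZ nn by (intro mult_right_mono mult_left_mono) auto
  moreover have "0 \<le> Z * (h / (h + e)) * X (Suc (Suc k))" using YZ ge nn by simp
  ultimately have "Q * X k \<le> (Y + Z) * X (Suc k)" unfolding rec by (simp add: algebra_simps)
  then show ?thesis1 by (simp add: Y_def Z_def Q_def)
  have "(4 * h + 5 * H) * Y * X (Suc k) \<le> 5 * (2 * h + H) * (Q * X k)"
  proof (cases "h + e = 0")
    \<comment> \<open>This happens only for \<open>k = M\<close>, at the right end of the mesh,
      where the claim is an equality.\<close>
    case True
    then have "h = 0" "e = 0" using ge by auto
    then show ?thesis unfolding rec by simp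
  next
    case False
    then have he: "0 < h + e" using ge by simp
    have eq: "(h + e) * (Q * X k) = (Y * (h + e) + Z * e) * X (Suc k) - Z * h * X (Suc (Suc k))"
    proof -
      define p q where "p = e / (h + e)" and "q = h / (h + e)"
      have pq: "p * (h + e) = e" "q * (h + e) = h" using he by (simp_all add: p_def q_def)
      have "(h + e) * (Q * X k) = (Y * (h + e) + Z * (p * (h + e))) * X (Suc k)
          - Z * (q * (h + e)) * X (Suc (Suc k))"
        unfolding rec p_def[symmetric] q_def[symmetric] by (simp add: algebra_simps)
      then show ?thesis unfolding pq .
    qed
    have "(h + e) * (5 * (2 * h + H) * (Q * X k)) = 5 * (2 * h + H) * ((h + e) * (Q * X k))" by simp
    also have "\<dots> = 5 * (2 * h + H) * (Y * (h + e) + Z * e) * X (Suc k)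
        - 5 * (2 * h + H) * Z * h * X (Suc (Suc k))"
      unfolding eq by (simp add: algebra_simps)
    also have "\<dots> \<ge> 5 * (2 * h + H) * (Y * (h + e) + Z * e) * X (Suc k)
        - 6 * h * (Y * (h + e) + Z * e) * X (Suc k)"
      using alt' by simp
    also have "5 * (2 * h + H) * (Y * (h + e) + Z * e) * X (Suc k)
        - 6 * h * (Y * (h + e) + Z * e) * X (Suc k)
        = (4 * h + 5 * H) * (Z * e * X (Suc k)) + (h + e) * ((4 * h + 5 * H) * Y * X (Suc k))"
      by (simp add: algebra_simps)
    also have "\<dots> \<ge> (h + e) * ((4 * h + 5 * H) * Y * X (Suc k))"
      using ge YZ nn by simp
    finally show ?thesis using he by simp
  qed
  then show ?thesis2 by (simp add: Y_def Q_def h_def H_def)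
qed

text \<open>Nonnegativity alone does not propagate, because the two terms in \<open>X_rec\<close>
  have opposite signs; a bound on their ratio is carried along. Going down from \<open>n\<close>,
  the lower bound in \<open>X_bounds_of\<close> controls \<open>X (k + 2)\<close> by
  \<open>X (k + 1)\<close>, and \<open>alternation_step\<close> turns this into the ratio bound at
  \<open>k\<close>.\<close>

lemma X_alternation:
  assumes "k < n"
  shows "0 \<le> X (Suc k) \<and> 0 \<le> X (Suc (Suc k)) \<and>
    5 * (2 * g (Suc k) + g k) * cf2 k * g (Suc k) * X (Suc (Suc k))
      \<le> 6 * g (Suc k) * (cf1 k * (g (Suc k) + g (Suc (Suc k))) + cf2 k * g (Suc (Suc k))) * X (Suc k)"
    (is "?P k")
proof -
  have YZ: "0 \<le> cf1 k" "0 \<le> cf2 k" if "k < n" for k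
    using coef_nonneg[OF adm g_nonneg, of k "Suc k"] that n by simp_all
  have "?P (n - Suc j)" if "j < n" for j
    using that
  proof (induction j)
    case 0
    then have "Suc (n - Suc 0) = n" by simp
    moreover have "X n = 1" by (simp add: X_def x_n)
    moreover have "X (Suc n) = 0" by (simp add: X_def x_gt)
    ultimately show ?case
      using YZ[of "n - Suc 0"] 0 g_nonneg by simp
  next
    case (Suc j)
    define k where "k = n - Suc (Suc j)"
    have k: "k < n" "Suc k < n" "n - Suc j = Suc k" using Suc.prems by (auto simp: k_def)
    have IH: "?P (Suc k)" using Suc k by simp
    define H h e where "H = g k" and "h = g (Suc k)" and "e = g (Suc (Suc k))"
    have h: "0 < h" using g_pos[of "Suc k"] k n by (simp add: h_def)
    have ge: "0 \<le> H" "0 \<le> e" by (simp_all add: H_def e_def g_nonneg)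
    define V where "V = cf1 k * (h + e) + cf2 k * e"
    have V: "0 \<le> V" using YZ[OF k(1)] h ge by (simp add: V_def)
    have piv: "0 < piv (Suc k)" using k n by (intro piv_pos) simp
    have low: "(4 * e + 5 * h) * cf1 (Suc k) * X (Suc (Suc k)) \<le> 5 * (2 * e + h) * (piv (Suc k) * X (Suc k))"
      using X_bounds_of(2)[of "Suc k"] IH k by (simp add: h_def e_def)
    have "0 \<le> (4 * e + 5 * h) * cf1 (Suc k) * X (Suc (Suc k))"
      using IH YZ[OF k(2)] h ge by simp
    then have "0 \<le> (5 * (2 * e + h) * piv (Suc k)) * X (Suc k)" using low by (simp add: mult.assoc)
    moreover have "0 < 5 * (2 * e + h) * piv (Suc k)" using h ge piv by simp
    ultimately have X1: "0 \<le> X (Suc k)" by (simp add: zero_le_mult_iff)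
    have "(5 * (2 * e + h) * piv (Suc k)) * (5 * (2 * h + H) * cf2 k * h * X (Suc (Suc k)))
        = h * X (Suc (Suc k)) * (25 * cf2 k * (2 * h + H) * (2 * e + h) * piv (Suc k))"
      by (simp add: algebra_simps)
    also have "\<dots> \<le> h * X (Suc (Suc k)) * (6 * V * (4 * e + 5 * h) * cf1 (Suc k))"
    proof (rule mult_left_mono)
      have "A (Suc k) \<le> 2 * h / 15 + H / 5" using A_le[of "Suc k"] k n by (simp add: H_def h_def)
      then show "25 * cf2 k * (2 * h + H) * (2 * e + h) * piv (Suc k) \<le> 6 * V * (4 * e + 5 * h) * cf1 (Suc k)"
        using alternation_step[OF adm[of k] adm[of "Suc k"], of e] h ge k n
        by (simp add: H_def h_def e_def V_def)
      show "0 \<le> h * X (Suc (Suc k))" using IH h by simp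
    qed
    also have "\<dots> = 6 * h * V * ((4 * e + 5 * h) * cf1 (Suc k) * X (Suc (Suc k)))"
      by (simp add: algebra_simps)
    also have "\<dots> \<le> 6 * h * V * (5 * (2 * e + h) * (piv (Suc k) * X (Suc k)))"
      using low V h by (intro mult_left_mono) auto
    also have "\<dots> = (5 * (2 * e + h) * piv (Suc k)) * (6 * h * V * X (Suc k))"
      by (simp add: algebra_simps)
    finally have "5 * (2 * h + H) * cf2 k * h * X (Suc (Suc k)) \<le> 6 * h * V * X (Suc k)"
      using \<open>0 < 5 * (2 * e + h) * piv (Suc k)\<close> by (simp only: mult_le_cancel_left_pos)
    then show ?case
      using X1 IH unfolding k_def[symmetric] by (simp add: H_def h_def e_def V_def)
  qed
  from this[of "n - Suc k"] assms show ?thesis by (simp add: Suc_diff_Suc)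
qed

lemma X_le: "k < n \<Longrightarrow> piv k * X k \<le> (cf1 k + cf2 k) * X (Suc k)"
  using X_bounds_of(1) X_alternation by blast

lemma X_nonneg: "k \<le> n \<Longrightarrow> 0 \<le> X k"
proof (cases "k = n")
  case False
  assume "k \<le> n"
  with False have k: "k < n" by simp
  have "0 \<le> (4 * g (Suc k) + 5 * g k) * cf1 k * X (Suc k)"
    using X_alternation[OF k] coef_nonneg[OF adm g_nonneg, of k "Suc k"] k n g_nonneg by simp
  also have "\<dots> \<le> 5 * (2 * g (Suc k) + g k) * (piv k * X k)"
    using X_bounds_of(2)[OF k] X_alternation[OF k] by blast
  also have "\<dots> = (5 * (2 * g (Suc k) + g k) * piv k) * X k" by simp
  finally have "0 \<le> (5 * (2 * g (Suc k) + g k) * piv k) * X k" .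
  moreover have "0 < 5 * (2 * g (Suc k) + g k) * piv k"
    using g_sum_pos[of k] g_nonneg[of "Suc k"] piv_pos[of k] k n by simp
  ultimately show ?thesis by (simp add: zero_le_mult_iff)
qed (simp add: X_def x_n)

abbreviation "pot k \<equiv> potential (g k) (A k) (pos (n + 2) - pos k)"

lemma potential_decay:
  assumes "k \<le> n"
  shows "X k * pot k \<le> (93 / 100) ^ (n - k) * (12 * knot_dist2 g n)"
proof -
  have "X (n - j) * pot (n - j) \<le> (93 / 100) ^ j * (12 * knot_dist2 g n)" if "j \<le> n" for j
    using that
  proof (induction j)
    case 0
    have "pos (n + 2) - pos n = g n + g (Suc n)" by (simp add: pos_Suc)
    then show ?case
      using potential_le_dist2[OF adm[OF n] g_nonneg, of "Suc n"]
      by (simp add: X_def x_n knot_dist2_def schur_eq)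
  next
    case (Suc j)
    define k where "k = n - Suc j"
    have k: "k < n" "n - j = Suc k" using Suc.prems by (auto simp: k_def)
    have pv: "0 < piv k" using k n by (intro piv_pos) simp
    define s where "s = pos (n + 2) - pos k"
    have s: "g k + g (Suc k) \<le> s" "s - g k = pos (n + 2) - pos (Suc k)"
      using pos_mono[of "Suc (Suc k)" "n + 2"] k by (auto simp: s_def pos_Suc)
    have pot0: "0 \<le> pot k"
      using potential_ge[OF g_nonneg[of k] g_nonneg[of "k - 1"] A_ge, of s] s k n g_nonneg[of "k - 1"] g_nonneg[of k] g_nonneg[of "Suc k"]
      by (simp add: s_def)
    have "piv k * (X k * pot k) \<le> (cf1 k + cf2 k) * X (Suc k) * pot k"
      using mult_right_mono[OF X_le[OF k(1)] pot0] by (simp add: mult.assoc)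
    also have "\<dots> = X (Suc k) * ((cf1 k + cf2 k) * potential (g k) (A k) s)" by (simp add: s_def)
    also have "\<dots> \<le> X (Suc k) * (93 / 100 * piv k * potential (g (Suc k)) (A (Suc k)) (s - g k))"
      unfolding schur_Suc using k n s X_nonneg[of "Suc k"]
      by (intro mult_left_mono potential_step adm g_nonneg g_sum_pos) auto
    also have "\<dots> = piv k * (93 / 100 * (X (Suc k) * pot (Suc k)))" by (simp add: s)
    finally have "X k * pot k \<le> 93 / 100 * (X (Suc k) * pot (Suc k))" using pv by simp
    also have "\<dots> \<le> 93 / 100 * ((93 / 100) ^ j * (12 * knot_dist2 g n))"
    proof (rule mult_left_mono)
      show "X (Suc k) * pot (Suc k) \<le> (93 / 100) ^ j * (12 * knot_dist2 g n)"
        using Suc.IH Suc.prems unfolding k(2) by linarith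
    qed simp
    finally show ?case unfolding k_def by simp
  qed
  from this[of "n - k"] assms show ?thesis by simp
qed

lemma knot_dist2_pos: "0 < knot_dist2 g n"
proof -
  have "0 < A n \<or> 0 < g (Suc n)"
  proof (cases "n = 0")
    case True
    then show ?thesis using g_pos[of 1] M by simp
  next
    case False
    then have "0 < g (n - 1) + g n" using g_sum_pos[of "n - 1"] n by simp
    then show ?thesis using A_ge[OF n] g_nonneg[of n] g_nonneg[of "n - 1"] by linarith
  qed
  then show ?thesis
    using dist2_pos[OF adm[OF n] g_nonneg, of "Suc n"] by (simp add: knot_dist2_def schur_eq)
qed

lemma knot_dist2_le: "knot_dist2 g n \<le> 4 / 15 * (pos (n + 2) - pos (n - 1))"
proof -
  have "pos (n + 2) - pos (n - 1) = g (n - 1) + g n + g (Suc n)"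
    by (cases n) (simp_all add: pos_Suc g_0 pos_def)
  then show ?thesis
    using dist2_le[OF adm[OF n] g_nonneg A_le[OF n] g_nonneg, of "Suc n"]
    by (simp add: knot_dist2_def schur_eq)
qed

text \<open>The difference of positions reaches from the left end of the support of B-spline
  \<open>k + 1\<close> to the right end of that of B-spline \<open>n + 1\<close>, so it is a value
  of \<open>\<eta>\<close>. The constant \<open>15\<close> rounds up
  \<open>12 * 20/17\<close>.\<close>

lemma column_decay:
  assumes "k \<le> n"
  shows "\<bar>x k\<bar> * (pos (n + 2) - pos (k - 1)) \<le> 15 * (93 / 100) ^ (n - k) * knot_dist2 g n"
proof -
  define P where "P = pos (n + 2) - pos (k - 1)"
  have P: "P = pos (n + 2) - pos k + g (k - 1)"
    by (cases k) (simp_all add: P_def pos_Suc g_0)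
  have "17 / 20 * P \<le> pot k"
    unfolding P using assms n pos_mono[of k "n + 2"]
    by (intro potential_ge g_nonneg A_ge) auto
  then have "X k * (17 / 20 * P) \<le> X k * pot k"
    using X_nonneg[OF assms] by (rule mult_left_mono)
  also have "\<dots> \<le> (93 / 100) ^ (n - k) * (12 * knot_dist2 g n)" by (rule potential_decay[OF assms])
  finally have "17 / 20 * (X k * P) \<le> 12 * ((93 / 100) ^ (n - k) * knot_dist2 g n)"
    by simp
  moreover have "0 \<le> (93 / 100) ^ (n - k) * knot_dist2 g n" using knot_dist2_pos by simp
  moreover have "\<bar>x k\<bar> = X k" using X_abs[of k] X_nonneg[OF assms] by simp
  ultimately show ?thesis unfolding P_def[symmetric] by simp
qed

end

subsection \<open>The inverse of the Gram block\<close>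

context mesh
begin

lemma form_add_scaled: "form (\<lambda>j. x j + c * y j) z = form x z + c * form y z"
proof -
  have "local_form g l (\<lambda>j. x j + c * y j) z = local_form g l x z + c * local_form g l y z" for l
    by (simp add: local_form_def knot_value_def bern_form_def algebra_simps add_divide_distrib)
  then show ?thesis by (simp add: form_def sum.distrib sum_distrib_left)
qed

lemma form_zero: "form (\<lambda>_. 0) z = 0"
  by (simp add: form_def local_form_def knot_value_def bern_form_def)

lemma form_expand:
  assumes "\<And>i. n \<le> i \<Longrightarrow> x i = 0"
  shows "form x z = (\<Sum>i<n. x i * form (unit_fun i) z)"
proof -
  have "form (\<lambda>j. \<Sum>i<k. x i * unit_fun i j) z = (\<Sum>i<k. x i * form (unit_fun i) z)" for k
    by (induction k) (simp_all add: form_zero form_add_scaled)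
  moreover have "x j = (\<Sum>i<n. x i * unit_fun i j)" for j
  proof (cases "j < n")
    case True
    then show ?thesis by (simp add: unit_fun_def if_distrib cong: if_cong)
  next
    case False
    then show ?thesis using assms[of j] by (auto simp: unit_fun_def intro!: sum.neutral[symmetric])
  qed
  ultimately show ?thesis by (metis (no_types, lifting) ext)
qed

text \<open>The shorter column is expanded in unit vectors; the longer one is orthogonal to all of
  them except possibly the last.\<close>

lemma columns_conjugate:
  assumes "mesh_column g M k x" "mesh_column g M l y" "k \<le> l"
  shows "form x y = (if k = l then knot_dist2 g l else 0)"
proof -
  interpret x: mesh_column g M k x by fact
  interpret y: mesh_column g M l y by fact
  have "form x y = (\<Sum>i<Suc k. x i * form (unit_fun i) y)"
    by (rule form_expand) (simp add: x.x_gt)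
  also have "\<dots> = (\<Sum>i<Suc k. x i * form y (unit_fun i))" by (simp add: form_commute)
  also have "\<dots> = (\<Sum>i<Suc k. if i = l then knot_dist2 g l else 0)"
  proof (rule sum.cong[OF refl])
    fix i assume i: "i \<in> {..<Suc k}"
    show "x i * form y (unit_fun i) = (if i = l then knot_dist2 g l else 0)"
    proof (cases "i = l")
      case True
      then have "k = l" using i assms(3) by auto
      then show ?thesis using True x.x_n form_last[OF y.n y.x_ann y.x_n y.x_gt] by simp
    next
      case False
      then have "i < l" using i assms(3) by auto
      then have "form y (unit_fun i) = 0"
        using y.n by (intro form_annihilated y.x_ann) auto
      then show ?thesis using False by simp
    qed
  qed
  also have "\<dots> = (if k = l then knot_dist2 g l else 0)" using assms(3) by auto
  finally show ?thesis .
qed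

definition column :: "nat \<Rightarrow> nat \<Rightarrow> real" where
  "column n = (SOME x. mesh_column g M n x)"

lemma mesh_column_column: "n \<le> Suc M \<Longrightarrow> mesh_column g M n (column n)"
proof -
  assume n: "n \<le> Suc M"
  from column_exists[OF n] obtain x where "x n = 1" "\<forall>l>n. x l = 0" "\<forall>l<n. annihilates g l x" by blast
  with n have "mesh_column g M n x" by unfold_locales auto
  then show ?thesis unfolding column_def by (rule someI[where P = "mesh_column g M n"])
qed

lemma form_columns:
  assumes "k \<le> Suc M" "l \<le> Suc M"
  shows "form (column k) (column l) = (if k = l then knot_dist2 g l else 0)"
proof (cases "k \<le> l")
  case True
  then show ?thesis using columns_conjugate mesh_column_column assms by blast
next
  case False
  then show ?thesis
    using columns_conjugate[of l "column l" k "column k"] mesh_column_column assms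
    by (simp add: form_commute[of "column k"])
qed

lemma column_simps:
  assumes "n \<le> Suc M"
  shows "column n n = 1" "n < l \<Longrightarrow> column n l = 0"
  using mesh_column.x_n[OF mesh_column_column[OF assms]] mesh_column.x_gt[OF mesh_column_column[OF assms]]
  by auto

definition inverse_entry :: "nat \<Rightarrow> nat \<Rightarrow> nat \<Rightarrow> real" where
  "inverse_entry n i j = (\<Sum>l<n. column l i * column l j / knot_dist2 g l)"

lemma inverse_entry_commute: "inverse_entry n i j = inverse_entry n j i"
  by (simp add: inverse_entry_def mult.commute)

text \<open>Let \<open>R\<close> be column \<open>j\<close> of the product. By conjugacy, pairing
  \<open>R\<close> with column \<open>k'\<close> gives entry \<open>j\<close> of that column, just
  as the unit vector would. The columns are unitriangular, so \<open>R\<close> is that unit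
  vector.\<close>

lemma inverse_entry:
  assumes n: "n \<le> Suc (Suc M)" and "k < n" "j < n"
  shows "(\<Sum>i<n. form (unit_fun k) (unit_fun i) * inverse_entry n i j) = (if k = j then 1 else 0)"
proof -
  define R where "R k = (\<Sum>i<n. form (unit_fun k) (unit_fun i) * inverse_entry n i j)" for k
  have d: "0 < knot_dist2 g l" if "l < n" for l
    using mesh_column.knot_dist2_pos[OF mesh_column_column[of l]] that n by simp
  have supp: "column l i = 0" if "l < n" "n \<le> i" for l i
    using that n by (intro column_simps) auto
  have R: "R k = (\<Sum>l<n. column l j / knot_dist2 g l * form (column l) (unit_fun k))" for k
  proof -
    have "R k = (\<Sum>i<n. \<Sum>l<n. column l j / knot_dist2 g l * (column l i * form (unit_fun i) (unit_fun k)))"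
      unfolding R_def inverse_entry_def sum_distrib_left
      by (intro sum.cong refl) (simp add: form_commute[of "unit_fun k"])
    also have "\<dots> = (\<Sum>l<n. column l j / knot_dist2 g l * (\<Sum>i<n. column l i * form (unit_fun i) (unit_fun k)))"
      by (subst sum.swap) (simp add: sum_distrib_left)
    also have "\<dots> = (\<Sum>l<n. column l j / knot_dist2 g l * form (column l) (unit_fun k))"
      by (intro sum.cong refl arg_cong2[where f = "(*)"] form_expand[symmetric]) (simp add: supp)
    finally show ?thesis .
  qed
  have tri: "(\<Sum>k<n. column k' k * R k) = column k' j" if k': "k' < n" for k'
  proof -
    have "(\<Sum>k<n. column k' k * R k)
        = (\<Sum>l<n. column l j / knot_dist2 g l * (\<Sum>k<n. column k' k * form (unit_fun k) (column l)))"
      unfolding R sum_distrib_left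
      by (subst sum.swap) (auto intro!: sum.cong simp: form_commute[of "unit_fun _"])
    also have "\<dots> = (\<Sum>l<n. column l j / knot_dist2 g l * form (column k') (column l))"
      using k' by (intro sum.cong refl arg_cong2[where f = "(*)"] form_expand[symmetric]) (simp add: supp)
    also have "\<dots> = (\<Sum>l<n. if l = k' then column k' j else 0)"
      using k' n d by (intro sum.cong refl) (auto simp: form_columns less_imp_neq[symmetric] dest: d)
    also have "\<dots> = column k' j" using k' by simp
    finally show ?thesis .
  qed
  have "R k = (if k = j then 1 else 0)" if "k < n" for k
    using that
  proof (induction k rule: less_induct)
    case (less k)
    have "(\<Sum>i<n. column k i * (if i = j then 1 else 0)) = (\<Sum>i<n. if i = j then column k i else 0)"
      by (intro sum.cong) auto
    also have "\<dots> = column k j" using assms(3) by simp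
    finally have "(\<Sum>i<n. column k i * (R i - (if i = j then 1 else 0))) = 0"
      using tri[OF less.prems] by (simp only: right_diff_distrib sum_subtractf)
    moreover have "(\<Sum>i<n. column k i * (R i - (if i = j then 1 else 0)))
        = (\<Sum>i<n. if i = k then R k - (if k = j then 1 else 0) else 0)"
    proof (intro sum.cong refl)
      fix i assume "i \<in> {..<n}"
      then show "column k i * (R i - (if i = j then 1 else 0))
          = (if i = k then R k - (if k = j then 1 else 0) else 0)"
        using less n column_simps[of k] by (cases i k rule: linorder_cases) auto
    qed
    ultimately show ?case using less.prems by simp
  qed
  then show ?thesis using assms(2) by (simp add: R_def)
qed

text \<open>The two factors of a rank one term are treated differently. The decay at
  \<open>i\<close> supplies the length and one factor \<open>E\<close>, which cancels the
  denominator; at \<open>j\<close> the length is traded for \<open>E\<close> by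
  \<open>knot_dist2_le\<close>, leaving the pure bound \<open>15 * 4/15 = 4\<close> times a
  power.\<close>

lemma inverse_entry_bound:
  assumes n: "n \<le> Suc (Suc M)" and ij: "i \<le> j" "j < n"
  shows "\<bar>inverse_entry n i j\<bar> * (pos (j + 2) - pos (i - 1)) \<le> 445 * (93 / 100) ^ (j - i)"
proof -
  define \<kappa> :: real where "\<kappa> = 93 / 100"
  define P where "P = pos (j + 2) - pos (i - 1)"
  have P: "0 \<le> P" unfolding P_def using pos_mono[of "i - 1" "j + 2"] ij by simp
  have term_bound: "\<bar>column l i * column l j / knot_dist2 g l\<bar> * P \<le> 60 * \<kappa> ^ (j - i) * (\<kappa>\<^sup>2) ^ (l - j)"
    if l: "j \<le> l" "l < n" for l
  proof -
    interpret c: mesh_column g M l "column l" using l n by (intro mesh_column_column) simp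
    define E where "E = knot_dist2 g l"
    define Pi Pj where "Pi = pos (l + 2) - pos (i - 1)" and "Pj = pos (l + 2) - pos (j - 1)"
    have E: "0 < E" unfolding E_def by (rule c.knot_dist2_pos)
    have "E \<le> 4 / 15 * (pos (l + 2) - pos (l - 1))" unfolding E_def by (rule c.knot_dist2_le)
    also have "\<dots> \<le> 4 / 15 * Pj" unfolding Pj_def using pos_mono[of "j - 1" "l - 1"] l by simp
    finally have EP: "E \<le> 4 / 15 * Pj" .
    then have Pj: "0 < Pj" using E by simp
    have PPi: "P \<le> Pi" unfolding P_def Pi_def using pos_mono[of "j + 2" "l + 2"] l by simp
    have bi: "\<bar>column l i\<bar> * Pi \<le> 15 * \<kappa> ^ (l - i) * E"
      unfolding Pi_def \<kappa>_def E_def using ij l by (intro c.column_decay) simp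
    have bj: "\<bar>column l j\<bar> * Pj \<le> 15 * \<kappa> ^ (l - j) * E"
      unfolding Pj_def \<kappa>_def E_def using l by (intro c.column_decay) simp
    have "\<bar>column l i\<bar> * P \<le> \<bar>column l i\<bar> * Pi" using PPi by (intro mult_left_mono) auto
    with bi have bi': "\<bar>column l i\<bar> * P \<le> 15 * \<kappa> ^ (l - i) * E" by simp
    have "\<bar>column l j\<bar> * E \<le> \<bar>column l j\<bar> * (4 / 15 * Pj)" using EP by (intro mult_left_mono) auto
    also have "\<dots> = 4 / 15 * (\<bar>column l j\<bar> * Pj)" by simp
    also have "\<dots> \<le> 4 / 15 * (15 * \<kappa> ^ (l - j) * E)" using bj by (rule mult_left_mono) simp
    finally have "\<bar>column l j\<bar> * E \<le> 4 * \<kappa> ^ (l - j) * E" by (simp add: mult_ac)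
    then have bj': "\<bar>column l j\<bar> \<le> 4 * \<kappa> ^ (l - j)" using E by simp
    have "(\<bar>column l i\<bar> * P) * \<bar>column l j\<bar> \<le> (15 * \<kappa> ^ (l - i) * E) * (4 * \<kappa> ^ (l - j))"
      using E by (intro mult_mono[OF bi' bj']) (simp_all add: \<kappa>_def)
    then have "\<bar>column l i\<bar> * \<bar>column l j\<bar> * P / E \<le> 60 * (\<kappa> ^ (l - i) * \<kappa> ^ (l - j))"
      using E by (simp add: field_simps)
    also have "l - i = (j - i) + (l - j)" using ij l by simp
    also have "\<kappa> ^ ((j - i) + (l - j)) * \<kappa> ^ (l - j) = \<kappa> ^ (j - i) * (\<kappa>\<^sup>2) ^ (l - j)"
      by (simp add: power_add power_mult[symmetric] mult_2)
    finally show ?thesis using E by (simp add: abs_mult E_def[symmetric] mult.assoc)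
  qed
  have zero: "column l j = 0" if "l < j" for l
    using that ij n by (intro column_simps) auto
  have "\<bar>inverse_entry n i j\<bar> * P \<le> (\<Sum>l<n. \<bar>column l i * column l j / knot_dist2 g l\<bar>) * P"
    unfolding inverse_entry_def using P by (intro mult_right_mono sum_abs)
  also have "\<dots> = (\<Sum>l\<in>{j..<n}. \<bar>column l i * column l j / knot_dist2 g l\<bar> * P)"
    unfolding sum_distrib_right by (intro sum.mono_neutral_right) (auto simp: zero)
  also have "\<dots> \<le> (\<Sum>l\<in>{j..<n}. 60 * \<kappa> ^ (j - i) * (\<kappa>\<^sup>2) ^ (l - j))"
    using term_bound by (intro sum_mono) auto
  also have "\<dots> = 60 * \<kappa> ^ (j - i) * (\<Sum>l\<in>{j..<n}. (\<kappa>\<^sup>2) ^ (l - j))" by (simp add: sum_distrib_left)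
  also have "(\<Sum>l\<in>{j..<n}. (\<kappa>\<^sup>2) ^ (l - j)) = (\<Sum>l<n - j. (\<kappa>\<^sup>2) ^ l)"
    using ij by (intro sum.reindex_bij_witness[of _ "\<lambda>l. l + j" "\<lambda>l. l - j"]) auto
  also have "\<dots> = (1 - (\<kappa>\<^sup>2) ^ (n - j)) / (1 - \<kappa>\<^sup>2)"
    by (subst sum_gp_strict) (simp add: \<kappa>_def power2_eq_square)
  also have "\<dots> \<le> 1 / (1 - \<kappa>\<^sup>2)" by (intro divide_right_mono) (simp_all add: \<kappa>_def power2_eq_square)
  \<comment> \<open>Numerically \<open>60 / (1 - 0.8649)\<close> is about
    \<open>444.1\<close>.\<close>
  also have "60 * \<kappa> ^ (j - i) * (1 / (1 - \<kappa>\<^sup>2)) \<le> 445 * \<kappa> ^ (j - i)"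
    by (simp add: \<kappa>_def power2_eq_square)
  finally show ?thesis by (simp add: P_def \<kappa>_def mult_left_mono)
qed

end

subsection \<open>Gram matrices of quadratic B-splines\<close>

definition bern_poly :: "real \<Rightarrow> real \<Rightarrow> real \<Rightarrow> real \<Rightarrow> real" where
  "bern_poly c0 c1 c2 u = c0 * (1 - u)\<^sup>2 + 2 * c1 * u * (1 - u) + c2 * u\<^sup>2"

lemma bern_poly_has_integral:
  fixes s h :: real
  assumes h: "0 < h"
  shows "((\<lambda>x. bern_poly x0 x1 x2 ((x - s) / h) * bern_poly y0 y1 y2 ((x - s) / h))
    has_integral h * bern_form x0 x1 x2 y0 y1 y2) {s..s + h}"
proof -
  define a0 a1 a2 where "a0 = x0" and "a1 = 2 * (x1 - x0)" and "a2 = x0 - 2 * x1 + x2"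
  define b0 b1 b2 where "b0 = y0" and "b1 = 2 * (y1 - y0)" and "b2 = y0 - 2 * y1 + y2"
  define q where "q u = a0 * b0 * u + (a0 * b1 + a1 * b0) / 2 * u ^ 2 + (a0 * b2 + a1 * b1 + a2 * b0) / 3 * u ^ 3
    + (a1 * b2 + a2 * b1) / 4 * u ^ 4 + a2 * b2 / 5 * u ^ 5" for u :: real
  have poly: "bern_poly x0 x1 x2 u = a0 + a1 * u + a2 * u\<^sup>2" "bern_poly y0 y1 y2 u = b0 + b1 * u + b2 * u\<^sup>2" for u
    by (simp_all add: bern_poly_def a0_def a1_def a2_def b0_def b1_def b2_def power2_eq_square algebra_simps)
  have q: "(q has_real_derivative bern_poly x0 x1 x2 u * bern_poly y0 y1 y2 u) (at u)" for u
    unfolding q_def poly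
    by (auto intro!: derivative_eq_intros simp: power_numeral_reduce field_simps)
  have lin: "((\<lambda>x. (x - s) / h) has_real_derivative 1 / h) (at x)" for x
    using h by (auto intro!: derivative_eq_intros)
  have "((\<lambda>x. h * q ((x - s) / h)) has_real_derivative
      bern_poly x0 x1 x2 ((x - s) / h) * bern_poly y0 y1 y2 ((x - s) / h)) (at x)" for x
    using DERIV_cmult[OF DERIV_chain2[OF q lin], of h] h by simp
  then have "((\<lambda>x. bern_poly x0 x1 x2 ((x - s) / h) * bern_poly y0 y1 y2 ((x - s) / h)) has_integral
      h * q ((s + h - s) / h) - h * q ((s - s) / h)) {s..s + h}"
    using h by (intro fundamental_theorem_of_calculus)
      (auto simp: has_real_derivative_iff_has_vector_derivative[symmetric] intro: has_field_derivative_at_within)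
  moreover have "q 1 = bern_form x0 x1 x2 y0 y1 y2"
    by (simp add: q_def bern_form_def a0_def a1_def a2_def b0_def b1_def b2_def field_simps)
  moreover have "q 0 = 0" by (simp add: q_def)
  ultimately show ?thesis using h by simp
qed

text \<open>The cutoff is there because \<open>t\<close> is arbitrary after index
  \<open>m + 3\<close>. The lengths at \<open>0\<close>, \<open>m - 1\<close> and \<open>m\<close>
  vanish through the multiple end knots, which leaves \<open>m - 2\<close> proper intervals.\<close>

definition mesh_of :: "nat \<Rightarrow> (nat \<Rightarrow> real) \<Rightarrow> nat \<Rightarrow> real" where
  "mesh_of m t k = (if k \<le> m then t (k + 3) - t (k + 2) else 0)"

locale knots =
  fixes m :: nat and t :: "nat \<Rightarrow> real"
  assumes m: "3 \<le> m" and knots: "knot_sequence m t"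
begin

abbreviation "g \<equiv> mesh_of m t"

lemma t_ends: "t 1 = 0" "t 2 = 0" "t 3 = 0" "t (m + 1) = 1" "t (m + 2) = 1" "t (m + 3) = 1"
  using knots by (simp_all add: knot_sequence_def)

lemma t_less: "3 \<le> k \<Longrightarrow> k \<le> m \<Longrightarrow> t k < t (Suc k)"
  using knots by (simp add: knot_sequence_def)

sublocale mesh g "m - 2"
proof
  show "g 0 = 0" using t_ends by (simp add: mesh_of_def numeral_2_eq_2 numeral_3_eq_3)
  show "0 < g k" if "1 \<le> k" "k \<le> m - 2" for k
    using t_less[of "k + 2"] that m by (simp add: mesh_of_def numeral_3_eq_3)
  show "g k = 0" if "m - 2 < k" for k
  proof -
    from that consider "m < k" | "k = m" | "m = Suc k" using m by linarith
    then show ?thesis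
      using t_ends m by cases (auto simp: mesh_of_def numeral_2_eq_2 numeral_3_eq_3)
  qed
  show "1 \<le> m - 2" using m by simp
qed

lemma t_eq_pos: "k \<le> m + 1 \<Longrightarrow> t (k + 2) = pos k"
proof (induction k)
  case 0
  then show ?case using t_ends by (simp add: pos_def numeral_2_eq_2)
next
  case (Suc k)
  then have "pos (Suc k) = t (k + 2) + g k" by (simp add: pos_Suc)
  also have "\<dots> = t (Suc k + 2)" using Suc.prems by (simp add: mesh_of_def numeral_2_eq_2 numeral_3_eq_3)
  finally show ?case by simp
qed

text \<open>Truncated subtraction covers \<open>k = 1\<close>, as \<open>t 1\<close> and
  \<open>t 2\<close> coincide.\<close>

lemma t_pos:
  assumes "1 \<le> k" "k \<le> m + 3"
  shows "t k = pos (k - 2)"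
proof (cases "k = 1")
  case True
  then show ?thesis using t_ends by (simp add: pos_def)
next
  case False
  then have "k - 2 + 2 = k" using assms by linarith
  moreover have "t (k - 2 + 2) = pos (k - 2)" using assms by (intro t_eq_pos) linarith
  ultimately show ?thesis by (simp only:)
qed

lemma t_mono:
  assumes "1 \<le> i" "i \<le> j" "j \<le> m + 3"
  shows "t i \<le> t j"
  using assms by (simp add: t_pos pos_mono)

lemma indicator_knots:
  assumes "3 \<le> k" "k \<le> m" "x \<in> {t k..<t (Suc k)}" "1 \<le> j" "j \<le> m + 2"
  shows "indicator {t j..<t (Suc j)} x = (if j = k then 1 else 0 :: real)"
proof (cases j k rule: linorder_cases)
  case less
  then have "t (Suc j) \<le> t k" using assms by (intro t_mono) auto
  then show ?thesis using less assms(3) by auto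
next
  case greater
  then have "t (Suc k) \<le> t j" using assms by (intro t_mono) auto
  then show ?thesis using greater assms(3) by auto
qed (use assms in auto)

text \<open>After unfolding the recursion only the indicator at \<open>l + 3\<close> survives, so
  just \<open>i = l\<close>, \<open>l + 1\<close>, \<open>l + 2\<close> contribute. The middle
  Bernstein coefficient is the B-spline coefficient itself; the outer two are the values at the end
  knots.\<close>

lemma bspline_local:
  assumes l: "l < m - 2" and x: "x \<in> {t (l + 3)..<t (l + 4)}" and i: "i < m"
  shows "bspline t 3 (Suc i) x = bern_poly (knot_value g l (unit_fun i)) (unit_fun i (Suc l))
    (knot_value g (Suc l) (unit_fun i)) ((x - t (l + 3)) / g (Suc l))"
proof -
  define k where "k = l + 3"
  define p h r where "p = g l" and "h = g (Suc l)" and "r = g (Suc (Suc l))"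
  have ge: "0 \<le> p" "0 \<le> r" by (simp_all add: p_def r_def g_nonneg)
  have h: "0 < h" using g_pos[of "Suc l"] l by (simp add: h_def)
  have lm: "l \<le> m" "Suc l \<le> m" "Suc (Suc l) \<le> m" using l by auto
  have t1: "t (Suc (Suc l)) = t k - p" "t (Suc k) = t k + h" "t (Suc (Suc k)) = t k + h + r"
    using lm by (simp_all add: p_def h_def r_def k_def mesh_of_def numeral_2_eq_2 numeral_3_eq_3)
  define ind :: "nat \<Rightarrow> real" where "ind j = indicator {t j..<t (Suc j)} x" for j
  have ind: "ind j = (if j = k then 1 else 0)" if "1 \<le> j" "j \<le> m + 2" for j
    unfolding ind_def using l x that
    by (intro indicator_knots) (auto simp: k_def eval_nat_numeral)
  have indk: "ind k = 1" using ind[of k] l by (auto simp: k_def)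
  define u where "u = (x - t k) / h"
  have xu: "x = t k + u * h" using h by (simp add: u_def)
  have b2: "bspline t (Suc (Suc 0)) j x = (x - t j) / (t (Suc j) - t j) * ind j
      + (t (Suc (Suc j)) - x) / (t (Suc (Suc j)) - t (Suc j)) * ind (Suc j)" for j
    by (simp add: ind_def)
  have b3: "bspline t 3 (Suc i) x = (x - t (Suc i)) / (t (Suc (Suc (Suc i))) - t (Suc i)) *
        ((x - t (Suc i)) / (t (Suc (Suc i)) - t (Suc i)) * ind (Suc i)
         + (t (Suc (Suc (Suc i))) - x) / (t (Suc (Suc (Suc i))) - t (Suc (Suc i))) * ind (Suc (Suc i)))
      + (t (Suc (Suc (Suc (Suc i)))) - x) / (t (Suc (Suc (Suc (Suc i)))) - t (Suc (Suc i))) *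
        ((x - t (Suc (Suc i))) / (t (Suc (Suc (Suc i))) - t (Suc (Suc i))) * ind (Suc (Suc i))
         + (t (Suc (Suc (Suc (Suc i)))) - x) / (t (Suc (Suc (Suc (Suc i)))) - t (Suc (Suc (Suc i))))
           * ind (Suc (Suc (Suc i))))"
    unfolding numeral_3_eq_3 bspline.simps(3) Let_def b2 by (simp add: ind_def)
  have rhs: "knot_value g l (unit_fun i) = (h * unit_fun i l + p * unit_fun i (Suc l)) / (p + h)"
    "knot_value g (Suc l) (unit_fun i) = (r * unit_fun i (Suc l) + h * unit_fun i (Suc (Suc l))) / (h + r)"
    by (simp_all add: knot_value_def p_def h_def r_def)
  consider "i = l" | "i = Suc l" | "i = Suc (Suc l)" | "i \<noteq> l" "i \<noteq> Suc l" "i \<noteq> Suc (Suc l)" by blast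
  then have "bspline t 3 (Suc i) x = bern_poly (knot_value g l (unit_fun i)) (unit_fun i (Suc l))
    (knot_value g (Suc l) (unit_fun i)) u"
  proof cases
    case 1
    then have k: "Suc (Suc (Suc i)) = k" and 0: "ind (Suc i) = 0" "ind (Suc (Suc i)) = 0"
      using i ind[of "Suc i"] ind[of "Suc (Suc i)"] by (auto simp: k_def)
    have ti: "t (Suc (Suc i)) = t k - p" using t1(1) 1 by simp
    have nz: "p + h \<noteq> 0" "h \<noteq> 0" using h ge by auto
    show ?thesis
      unfolding b3 rhs k 0 t1(2) ti using 1 indk nz
      by (simp add: unit_fun_def bern_poly_def xu power2_eq_square divide_simps)
        (simp add: algebra_simps)
  next
    case 2
    then have k: "Suc (Suc i) = k" and 0: "ind (Suc i) = 0" "ind (Suc k) = 0"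
      using i ind[of "Suc i"] ind[of "Suc k"] by (auto simp: k_def)
    have ti: "t (Suc i) = t k - p" using t1(1) 2 by simp
    have nz: "p + h \<noteq> 0" "h + r \<noteq> 0" "h \<noteq> 0" using h ge by auto
    show ?thesis
      unfolding b3 rhs k 0 t1(2,3) ti using 2 indk nz
      by (simp add: unit_fun_def bern_poly_def xu power2_eq_square divide_simps)
        (simp add: algebra_simps)
  next
    case 3
    then have k: "Suc i = k" and 0: "ind (Suc k) = 0" "ind (Suc (Suc k)) = 0"
      using i ind[of "Suc k"] ind[of "Suc (Suc k)"] by (auto simp: k_def)
    then show ?thesis
      unfolding b3 rhs unfolding k 0 t1(2,3) using 3 indk h ge
      by (simp add: unit_fun_def bern_poly_def xu power2_eq_square divide_simps)
  next
    case 4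
    then have "ind (Suc i) = 0" "ind (Suc (Suc i)) = 0" "ind (Suc (Suc (Suc i))) = 0"
      using i ind[of "Suc i"] ind[of "Suc (Suc i)"] ind[of "Suc (Suc (Suc i))"] by (auto simp: k_def)
    then show ?thesis
      unfolding b3 rhs using 4 by (simp add: unit_fun_def bern_poly_def)
  qed
  then show ?thesis by (simp add: u_def k_def h_def)
qed

lemma inner_bspline:
  assumes "i < m" "j < m"
  shows "inner_L2 (bspline t 3 (Suc i)) (bspline t 3 (Suc j)) = form (unit_fun i) (unit_fun j)"
proof -
  let ?f = "\<lambda>x. bspline t 3 (Suc i) x * bspline t 3 (Suc j) x"
  have piece: "(?f has_integral local_form g l (unit_fun i) (unit_fun j)) {t (l + 3)..t (l + 4)}"
    if l: "l < m - 2" for l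
  proof -
    have "Suc l \<le> m" using l by auto
    then have eq: "t (l + 4) = t (l + 3) + g (Suc l)" by (simp add: mesh_of_def eval_nat_numeral)
    have h: "0 < g (Suc l)" using g_pos[of "Suc l"] l by simp
    show ?thesis
      unfolding eq local_form_def
      \<comment> \<open>The local formula holds on the half-open interval; its right end is a null
        set.\<close>
      by (rule has_integral_spike_finite[OF _ _ bern_poly_has_integral[OF h], of "{t (l + 4)}"])
        (use assms l in \<open>auto simp: eq bspline_local\<close>)
  qed
  have "(?f has_integral (\<Sum>l<k. local_form g l (unit_fun i) (unit_fun j))) {t 3..t (k + 3)}"
    if "k \<le> m - 2" for k
    using that
  proof (induction k)
    case 0
    then show ?case by (simp add: has_integral_refl(2))
  next
    case (Suc k)
    have "(?f has_integral (\<Sum>l<k. local_form g l (unit_fun i) (unit_fun j))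
        + local_form g k (unit_fun i) (unit_fun j)) {t 3..t (k + 4)}"
      using Suc by (intro has_integral_combine[OF _ _ Suc.IH piece] t_mono) auto
    then show ?case by (simp add: eval_nat_numeral)
  qed
  moreover have "m - 2 + 3 = m + 1" using m by simp
  ultimately have "(?f has_integral form (unit_fun i) (unit_fun j)) {0..1}"
    using t_ends by (metis form_def order_refl)
  then show ?thesis unfolding inner_L2_def by (rule integral_unique)
qed

end

lemma q_const_ge: "93 / 100 \<le> q_const"
  unfolding q_const_def by (rule real_le_rsqrt) (simp add: power2_eq_square)

text \<open>The actual value is about \<open>505\<close>.\<close>

lemma C1_const_ge: "445 \<le> C1_const"
proof -
  have q2: "q_const\<^sup>2 = 87 / 100" by (simp add: q_const_def)
  have "C_const = 12 * inverse (q_const\<^sup>2) * (6 / 5)\<^sup>2"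
    unfolding C_const_def by (simp add: power_int_minus)
  then have C: "C_const = 576 / 29" by (simp only: q2) (simp add: power2_eq_square)
  show ?thesis unfolding C1_const_def C q2 by simp
qed

context knots
begin

lemma gram_block_inverse:
  assumes n: "n \<le> m"
  shows "upper_left_block n (gram_matrix t m) * mat n n (\<lambda>(i, j). inverse_entry n i j) = 1\<^sub>m n"
proof (rule eq_matI)
  fix i j assume "i < dim_row (1\<^sub>m n :: real mat)" "j < dim_col (1\<^sub>m n :: real mat)"
  then have ij: "i < n" "j < n" by simp_all
  have "(upper_left_block n (gram_matrix t m) * mat n n (\<lambda>(i, j). inverse_entry n i j)) $$ (i, j)
      = (\<Sum>k<n. form (unit_fun i) (unit_fun k) * inverse_entry n k j)"
    using ij n m
    by (simp add: upper_left_block_def gram_matrix_def scalar_prod_def inner_bspline atLeast0LessThan)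
  also have "\<dots> = (if i = j then 1 else 0)" using ij n m by (intro inverse_entry) auto
  finally show "(upper_left_block n (gram_matrix t m) * mat n n (\<lambda>(i, j). inverse_entry n i j)) $$ (i, j)
      = 1\<^sub>m n $$ (i, j)" using ij by simp
qed (simp_all add: upper_left_block_def)

lemma inverse_entry_eta:
  assumes n: "n \<le> m" and ij: "1 \<le> i" "i \<le> j" "j \<le> n"
  shows "\<bar>inverse_entry n (i - 1) (j - 1)\<bar> \<le> C1_const * (q_const ^ (j - i) / (t (j + 3) - t i))"
proof -
  define P where "P = t (j + 3) - t i"
  have P: "P = pos (j - 1 + 2) - pos (i - 1 - 1)"
    unfolding P_def using ij n by (simp add: t_pos numeral_2_eq_2 numeral_3_eq_3)
  \<comment> \<open>For \<open>j < 3\<close> the interval starting at \<open>t j\<close> is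
    degenerate; the one starting at \<open>t 3\<close> still lies between \<open>t i\<close> and
    \<open>t (j + 3)\<close>.\<close>
  have "t (max 3 j) < t (Suc (max 3 j))" using ij n m by (intro t_less) auto
  moreover have "t i \<le> t (max 3 j)" "t (Suc (max 3 j)) \<le> t (j + 3)"
    using ij n m by (intro t_mono; simp)+
  ultimately have P0: "0 < P" by (simp add: P_def)
  have "\<bar>inverse_entry n (i - 1) (j - 1)\<bar> * P \<le> 445 * (93 / 100) ^ (j - 1 - (i - 1))"
    unfolding P using ij n m by (intro inverse_entry_bound) auto
  also have "\<dots> \<le> C1_const * q_const ^ (j - 1 - (i - 1))"
    using C1_const_ge q_const_ge by (intro mult_mono power_mono) auto
  also have "j - 1 - (i - 1) = j - i" using ij by simp
  finally show ?thesis using P0 by (simp add: P_def field_simps)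
qed

end

theorem theorem5p9:
  fixes m n :: nat and t :: "nat \<Rightarrow> real" and A A\<^sub>n :: "real mat"
  assumes "3 \<le> m"
    and "knot_sequence m t"
    and "1 \<le> n" "n \<le> m"
    and "A = gram_matrix t m"
    and "A\<^sub>n = upper_left_block n A"
  shows "invertible_mat A\<^sub>n \<and>
    (\<forall>B\<in>carrier_mat n n. inverts_mat A\<^sub>n B \<and> inverts_mat B A\<^sub>n \<longrightarrow>
      (\<forall>i\<in>{1..n}. \<forall>j\<in>{1..n}.
        \<bar>B $$ (i - 1, j - 1)\<bar> \<le> C1_const * (q_const ^ nat \<bar>int i - int j\<bar> / \<eta> t i j)))"
proof -
  interpret knots m t using assms(1,2) by unfold_locales
  define M where "M = mat n n (\<lambda>(i, j). inverse_entry n i j)"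
  have M: "M \<in> carrier_mat n n" by (simp add: M_def)
  have An: "A\<^sub>n \<in> carrier_mat n n" by (simp add: assms(6) upper_left_block_def)
  have AM: "A\<^sub>n * M = 1\<^sub>m n"
    unfolding assms(5,6) M_def by (rule gram_block_inverse[OF assms(4)])
  then have MA: "M * A\<^sub>n = 1\<^sub>m n" by (rule mat_mult_left_right_inverse[OF An M])
  have "invertible_mat A\<^sub>n"
    using An M AM MA by (auto simp: invertible_mat_def inverts_mat_def square_mat.simps)
  moreover have "\<bar>B $$ (i - 1, j - 1)\<bar> \<le> C1_const * (q_const ^ nat \<bar>int i - int j\<bar> / \<eta> t i j)"
    if B: "B \<in> carrier_mat n n" "inverts_mat B A\<^sub>n" and ij: "i \<in> {1..n}" "j \<in> {1..n}" for B i j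
  proof -
    have "B = B * (A\<^sub>n * M)" using AM B by simp
    also have "\<dots> = (B * A\<^sub>n) * M" using B An M by (simp add: assoc_mult_mat)
    also have "\<dots> = M" using B M by (auto simp: inverts_mat_def)
    finally have B_eq: "B $$ (i - 1, j - 1) = inverse_entry n (i - 1) (j - 1)"
      using ij by (auto simp: M_def)
    show ?thesis
    proof (cases "i \<le> j")
      case True
      then have "nat \<bar>int i - int j\<bar> = j - i" by simp
      then show ?thesis
        using inverse_entry_eta[OF assms(4), of i j] True ij
        unfolding B_eq by (simp add: \<eta>_def max_def min_def)
    next
      case False
      then have "nat \<bar>int i - int j\<bar> = i - j" by simp
      then show ?thesis
        using inverse_entry_eta[OF assms(4), of j i] False ij
        unfolding B_eq inverse_entry_commute[of n "i - 1"] by (simp add: \<eta>_def max_def min_def)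
    qed
  qed
  ultimately show ?thesis by blast
qed

end
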